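(* Suppose that for some $\sigma$-field $\mathcal{X}\subset\mathcal{B}$ the following hold. 1. $\mathcal{X}\subset T^{-1}\mathcal{X}$. 2. The following martingales converge uniformly: $$\mathop{\mathrm{ess\,sup}}_{u\in\mathbb{U}_0}\big|\mathbf{E}[\ell_0(u)|\mathcal{Y}_{-\infty,0}\vee T^{-n}\mathcal{X}]-\ell_0(u)\big|\xrightarrow{n\to\infty}0\quad\text{in }L^1,$$ $$\mathop{\mathrm{ess\,sup}}_{u\in\mathbb{U}_0}\Big|\mathbf{E}[\ell_0(u)|\mathcal{Y}_{-\infty,0}\vee T^{n}\mathcal{X}]-\mathbf{E}\Big[\ell_0(u)\Big|\bigcap_{k=1}^\infty(\mathcal{Y}_{-\infty,0}\vee T^{k}\mathcal{X})\Big]\Big|\xrightarrow{n\to\infty}0\quad\text{in }L^1.$$ 3. The remote past does not affect the asymptotic loss: $$L^\star:=\mathbf{E}\Big[\mathop{\mathrm{ess\,inf}}_{u\in\mathbb{U}_0}\mathbf{E}[\ell_0(u)|\mathcal{Y}_{-\infty,0}]\Big]=\mathbf{E}\Big[\mathop{\mathrm{ess\,inf}}_{u\in\mathbb{U}_0}\mathbf{E}\Big[\ell_0(u)\Big|\bigcap_{k=1}^\infty(\mathcal{Y}_{-\infty,0}\vee T^{k}\mathcal{X})\Big]\Big].$$ Then there exists an admissible strategy $\mathbf{u}^\star$ such that for every admissible strategy $\mathbf{u}$ $$\liminf_{N\to\infty}\{L_N(\mathbf{u})-L_N(\mathbf{u}^\star)\}\ge0\quad\text{a.s.},\qquad \lim_{N\to\infty}L_N(\mathbf{u}^\star)=L^\star\quad\text{a.s.},$$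 that is, $\mathbf{u}^\star$ is pathwise optimal and $L^\star$ is the optimal long time-average loss.
   Context: Setting: $(\Omega,\mathcal{B},\mathbf{P})$ is a probability space, $\mathcal{Y}\subseteq\mathcal{B}$ a sub-$\sigma$-field, $T:\Omega\to\Omega$ an invertible (bimeasurable) measure-preserving ergodic transformation, $(U,\mathcal{U})$ a measurable space of decisions. For a $\sigma$-field $\mathcal{A}$ and $k\in\mathbb{Z}$, $T^k\mathcal{A}=\{T^kA:A\in\mathcal{A}\}$. For $-\infty\le m\le n\le\infty$, $\mathcal{Y}_{m,n}=\bigvee_{k=m}^n T^{-k}\mathcal{Y}$. For $m\le n$, $\mathbb{U}_{m,n}$ is the set of $\mathcal{Y}_{m,n}$-measurable maps $u:\Omega\to U$, and $\mathbb{U}_n=\bigcup_{-\infty<m\le n}\mathbb{U}_{m,n}$. Loss: $\ell:U\times\Omega\to\mathbb{R}$ is measurable and $|\ell(u,\omega)|\le\Lambda(\omega)$ for all $(u,\omega)$ with $\Lambda\in L^1(\mathbf{P})$. For $n\in\mathbb{Z}$, $\ell_n(u)(\omega)=\ell(u,T^n\omega)$; for a random decision $u:\Omega\to U$, $\ell_n(u)(\omega)=\ell(u(\omega),T^n\omega)$. A strategy $\mathbf{u}=(u_k)_{k\ge1}$ is admissible if $u_k\in\mathbb{U}_{0,k}$ for every $k\ge 1$. Its time-average loss over horizon $N$ is $L_N(\mathbf{u})=\frac1N\sum_{k=1}^N\ell_k(u_k)$. *)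

theory Defs
  imports "HOL-Probability.Probability"
begin

text \<open>Sub-\<open>\<sigma>\<close>-fields of \<open>M\<close> are represented by measures \<open>F\<close> with \<open>subalgebra M F\<close>, as in
  \<^const>\<open>real_cond_exp\<close>; only \<open>space F\<close> and \<open>sets F\<close> matter.\<close>

definition invertible_measure_preserving :: "'a measure \<Rightarrow> ('a \<Rightarrow> 'a) \<Rightarrow> bool" where
  "invertible_measure_preserving M T \<longleftrightarrow>
     bij_betw T (space M) (space M) \<and>
     T \<in> M \<rightarrow>\<^sub>M M \<and>
     the_inv_into (space M) T \<in> M \<rightarrow>\<^sub>M M \<and>
     distr M M T = M"

definition ergodic_transformation :: "'a measure \<Rightarrow> ('a \<Rightarrow> 'a) \<Rightarrow> bool" where
  "ergodic_transformation M T \<longleftrightarrow>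
     (\<forall>A\<in>sets M. T -` A \<inter> space M = A \<longrightarrow> measure M A = 0 \<or> measure M A = 1)"

definition T_pow :: "'a measure \<Rightarrow> ('a \<Rightarrow> 'a) \<Rightarrow> int \<Rightarrow> 'a \<Rightarrow> 'a" where
  "T_pow M T k = (if 0 \<le> k then T ^^ nat k else the_inv_into (space M) T ^^ nat (- k))"

text \<open>\<open>T\<^sup>k \<A> = {T\<^sup>k A | A \<in> \<A>}\<close>. When \<open>T\<close> is invertible this family is already a
  \<open>\<sigma>\<close>-field, so the \<^const>\<open>sigma\<close> below only turns it into an object of type \<^typ>\<open>'a measure\<close>;
  the same remark applies to the intersection in \<open>remote_field\<close>.\<close>

definition T_image :: "'a measure \<Rightarrow> ('a \<Rightarrow> 'a) \<Rightarrow> int \<Rightarrow> 'a measure \<Rightarrow> 'a measure" where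
  "T_image M T k F = sigma (space M) {T_pow M T k ` A | A. A \<in> sets F}"

definition field_join :: "'a measure \<Rightarrow> 'a measure \<Rightarrow> 'a measure \<Rightarrow> 'a measure" where
  "field_join M F G = sigma (space M) (sets F \<union> sets G)"

text \<open>The join of \<open>T\<^sup>-\<^sup>k \<Y>\<close> over \<open>k \<in> K\<close>: \<open>\<Y>\<^sub>m\<^sub>,\<^sub>n\<close> is obtained with \<open>K = {m..n}\<close>, and
  \<open>\<Y>\<^sub>-\<^sub>\<infinity>\<^sub>,\<^sub>n\<close> with \<open>K = {..n}\<close>.\<close>

definition obs_field :: "'a measure \<Rightarrow> ('a \<Rightarrow> 'a) \<Rightarrow> 'a measure \<Rightarrow> int set \<Rightarrow> 'a measure" where
  "obs_field M T Y K = sigma (space M) (\<Union>k\<in>K. sets (T_image M T (- k) Y))"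

definition remote_field :: "'a measure \<Rightarrow> ('a \<Rightarrow> 'a) \<Rightarrow> 'a measure \<Rightarrow> 'a measure \<Rightarrow> 'a measure" where
  "remote_field M T Y X =
     sigma (space M)
       (\<Inter>k\<in>{1::int..}. sets (field_join M (obs_field M T Y {..0}) (T_image M T k X)))"

definition decisions_between ::
  "'a measure \<Rightarrow> ('a \<Rightarrow> 'a) \<Rightarrow> 'a measure \<Rightarrow> 'u measure \<Rightarrow> int \<Rightarrow> int \<Rightarrow> ('a \<Rightarrow> 'u) set" where
  "decisions_between M T Y U m n = obs_field M T Y {m..n} \<rightarrow>\<^sub>M U"

definition decisions ::
  "'a measure \<Rightarrow> ('a \<Rightarrow> 'a) \<Rightarrow> 'a measure \<Rightarrow> 'u measure \<Rightarrow> int \<Rightarrow> ('a \<Rightarrow> 'u) set" where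
  "decisions M T Y U n = (\<Union>m\<in>{..n}. decisions_between M T Y U m n)"

definition loss_at ::
  "'a measure \<Rightarrow> ('a \<Rightarrow> 'a) \<Rightarrow> ('u \<Rightarrow> 'a \<Rightarrow> real) \<Rightarrow> int \<Rightarrow> ('a \<Rightarrow> 'u) \<Rightarrow> 'a \<Rightarrow> real" where
  "loss_at M T l n u = (\<lambda>\<omega>. l (u \<omega>) (T_pow M T n \<omega>))"

text \<open>The value of a strategy at index \<open>0\<close> is irrelevant; strategies start at time \<open>1\<close>.\<close>

definition admissible ::
  "'a measure \<Rightarrow> ('a \<Rightarrow> 'a) \<Rightarrow> 'a measure \<Rightarrow> 'u measure \<Rightarrow> (nat \<Rightarrow> 'a \<Rightarrow> 'u) \<Rightarrow> bool" where
  "admissible M T Y U u \<longleftrightarrow> (\<forall>k\<ge>1. u k \<in> decisions_between M T Y U 0 (int k))"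

definition avg_loss ::
  "'a measure \<Rightarrow> ('a \<Rightarrow> 'a) \<Rightarrow> ('u \<Rightarrow> 'a \<Rightarrow> real) \<Rightarrow> nat \<Rightarrow> (nat \<Rightarrow> 'a \<Rightarrow> 'u) \<Rightarrow> 'a \<Rightarrow> real" where
  "avg_loss M T l N u \<omega> = (1 / real N) * (\<Sum>k=1..N. loss_at M T l (int k) (u k) \<omega>)"

text \<open>Essential supremum and infimum of a possibly uncountable family \<open>(f i)\<^sub>i\<^sub>\<in>\<^sub>I\<close> of random
  variables, i.e. the least measurable almost sure upper bound (greatest lower bound), unique up
  to a null set. This differs from \<^const>\<open>esssup\<close>, which is the essential supremum of a single
  function.\<close>

definition is_family_esssup ::
  "'a measure \<Rightarrow> 'i set \<Rightarrow> ('i \<Rightarrow> 'a \<Rightarrow> ereal) \<Rightarrow> ('a \<Rightarrow> ereal) \<Rightarrow> bool" where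
  "is_family_esssup M I f g \<longleftrightarrow>
     g \<in> borel_measurable M \<and>
     (\<forall>i\<in>I. AE \<omega> in M. f i \<omega> \<le> g \<omega>) \<and>
     (\<forall>h\<in>borel_measurable M. (\<forall>i\<in>I. AE \<omega> in M. f i \<omega> \<le> h \<omega>) \<longrightarrow> (AE \<omega> in M. g \<omega> \<le> h \<omega>))"

definition is_family_essinf ::
  "'a measure \<Rightarrow> 'i set \<Rightarrow> ('i \<Rightarrow> 'a \<Rightarrow> ereal) \<Rightarrow> ('a \<Rightarrow> ereal) \<Rightarrow> bool" where
  "is_family_essinf M I f g \<longleftrightarrow>
     g \<in> borel_measurable M \<and>
     (\<forall>i\<in>I. AE \<omega> in M. g \<omega> \<le> f i \<omega>) \<and>
     (\<forall>h\<in>borel_measurable M. (\<forall>i\<in>I. AE \<omega> in M. h \<omega> \<le> f i \<omega>) \<longrightarrow> (AE \<omega> in M. h \<omega> \<le> g \<omega>))"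

definition family_esssup :: "'a measure \<Rightarrow> 'i set \<Rightarrow> ('i \<Rightarrow> 'a \<Rightarrow> ereal) \<Rightarrow> 'a \<Rightarrow> ereal" where
  "family_esssup M I f = (SOME g. is_family_esssup M I f g)"

definition family_essinf :: "'a measure \<Rightarrow> 'i set \<Rightarrow> ('i \<Rightarrow> 'a \<Rightarrow> ereal) \<Rightarrow> 'a \<Rightarrow> ereal" where
  "family_essinf M I f = (SOME g. is_family_essinf M I f g)"

definition tendsto_zero_L1 :: "'a measure \<Rightarrow> (nat \<Rightarrow> 'a \<Rightarrow> ereal) \<Rightarrow> bool" where
  "tendsto_zero_L1 M f \<longleftrightarrow> (\<lambda>n. \<integral>\<^sup>+ \<omega>. e2ennreal \<bar>f n \<omega>\<bar> \<partial>M) \<longlonglongrightarrow> 0"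

text \<open>\<open>E[ess inf\<^sub>u E[\<ell>\<^sub>0(u) | F]]\<close> over \<open>u \<in> U\<^sub>0\<close>. For a loss dominated by an integrable \<open>\<Lambda>\<close> and a
  nonempty \<open>U\<close>, the essential infimum is dominated by \<open>E[\<Lambda> | F]\<close>, hence almost surely finite and
  integrable, so that passing to \<^const>\<open>real_of_ereal\<close> loses nothing.\<close>

definition mean_optimal_loss ::
  "'a measure \<Rightarrow> ('a \<Rightarrow> 'a) \<Rightarrow> 'a measure \<Rightarrow> 'u measure \<Rightarrow> ('u \<Rightarrow> 'a \<Rightarrow> real) \<Rightarrow> 'a measure \<Rightarrow> real" where
  "mean_optimal_loss M T Y U l F =
     (\<integral>\<omega>. real_of_ereal
        (family_essinf M (decisions M T Y U 0)
           (\<lambda>u \<omega>. ereal (real_cond_exp M F (loss_at M T l 0 u) \<omega>)) \<omega>) \<partial>M)"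

definition L_star ::
  "'a measure \<Rightarrow> ('a \<Rightarrow> 'a) \<Rightarrow> 'a measure \<Rightarrow> 'u measure \<Rightarrow> ('u \<Rightarrow> 'a \<Rightarrow> real) \<Rightarrow> real" where
  "L_star M T Y U l = mean_optimal_loss M T Y U l (obs_field M T Y {..0})"

end

theory Submission
  imports Defs
begin

text \<open>Shifting to time \<open>0\<close>, a strategy \<open>u\<close> has loss \<open>\<ell>\<^sub>k(u\<^sub>k) = \<ell>\<^sub>0(v\<^sub>k) \<circ> T\<^sup>k\<close> with \<open>v\<^sub>k \<in> U\<^sub>0\<close>. Along the
  two-sided filtration \<open>G\<^sub>j = Y\<^sub>-\<^sub>\<infinity>\<^sub>,\<^sub>0 \<or> T\<^sup>-\<^sup>jX\<close> the variable \<open>\<ell>\<^sub>0(v\<^sub>k)\<close> splits into two end terms, which are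
  dominated uniformly in \<open>v\<^sub>k\<close> and hence averaged away by Birkhoff's theorem, and finitely many
  increments \<open>E[\<ell>\<^sub>0(v\<^sub>k) | G\<^sub>j] - E[\<ell>\<^sub>0(v\<^sub>k) | G\<^sub>j\<^sub>-\<^sub>1]\<close>. Since \<open>T\<^sup>-\<^sup>1\<close> is measurable from \<open>G\<^sub>j\<^sub>-\<^sub>1\<close> to \<open>G\<^sub>j\<close>,
  the increments composed with \<open>T\<^sup>k\<close> are orthogonal, so after truncating \<open>\<Lambda>\<close> they average to \<open>0\<close>.
  Therefore the average loss of \<open>u\<close> is asymptotic to the average of \<open>E[\<ell>\<^sub>0(v\<^sub>k) | G\<^sub>-\<^sub>\<infinity>] \<circ> T\<^sup>k\<close>. This is
  bounded below by the ergodic average of the essential infimum over \<open>U\<^sub>0\<close>, whose mean is \<open>L\<^sup>\<star>\<close> by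
  assumption. Conversely, if \<open>v\<^sub>k\<close> runs slowly enough through decisions in \<open>U\<^sub>0\<close> of mean loss at
  most \<open>L\<^sup>\<star> + 2\<^sup>-\<^sup>j\<close>, the excess over the essential infimum is summable and the bound is attained.\<close>

section \<open>Orthogonal sequences and essential suprema\<close>

text \<open>The decisions \<open>v k\<close> change with \<open>k\<close>, so the ergodic theorem
  does not apply to their losses along the orbit. It is used only for fixed functions: envelopes
  valid for all of U_0 at once, and the essential infimum. This is why convergence of the
  martingales must be uniform in u; the increments between the ends do depend on the decisions, but
  orthogonality suffices for them. Orthogonality comes from loss of information under T^{-1}:
  looking one step back drops an observation, and T^{-j}X pulls back to T^{-(j-1)}X. Hypothesis 3
  gives the lower bound its value \<open>L_star\<close> and also makes it attainable. The mean loss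
  of a decision does not depend on the field one conditions on, so a decision within 2^{-j} of
  \<open>L_star\<close> exceeds the remote essential infimum by at most 2^{-j} in mean. The other
  obstacle is memory. Members of U_0 see finitely many observations, whereas the event on which one
  decision beats another depends on the whole past. Decisions can therefore be glued only up to an
  error, measured with the weight \<open>\<Lambda>\<close>.\<close>

lemma AE_tendsto_zeroI:
  fixes f :: "nat \<Rightarrow> 'a \<Rightarrow> real"
  assumes "\<And>e. e > 0 \<Longrightarrow> AE \<omega> in M. eventually (\<lambda>n. \<bar>f n \<omega>\<bar> \<le> e) sequentially"
  shows "AE \<omega> in M. (\<lambda>n. f n \<omega>) \<longlonglongrightarrow> 0"
proof -
  have "AE \<omega> in M. \<forall>i. eventually (\<lambda>n. \<bar>f n \<omega>\<bar> \<le> inverse (real (Suc i))) sequentially"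
    unfolding AE_all_countable using assms by simp
  then show ?thesis
  proof eventually_elim
    case (elim \<omega>)
    show ?case
    proof (rule tendstoI)
      fix e :: real assume "e > 0"
      then obtain i where i: "inverse (real (Suc i)) < e" using reals_Archimedean by blast
      show "\<forall>\<^sub>F n in sequentially. dist (f n \<omega>) 0 < e"
        using elim[rule_format, of i] by eventually_elim (use i in auto)
    qed
  qed
qed

text \<open>For n^2 <= N < (n+1)^2 at most 2n steps, each of size at most C, lead from n^2 to N.
  After division by N >= n^2 they contribute at most 2C/n.\<close>

lemma square_gap_bound:
  fixes s :: "nat \<Rightarrow> real"
  assumes step: "\<And>n. \<bar>s (Suc n) - s n\<bar> \<le> C"
    and lim: "(\<lambda>n. s ((Suc n)^2) / real ((Suc n)^2)) \<longlonglongrightarrow> 0"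
  shows "(\<lambda>N. s N / real N) \<longlonglongrightarrow> 0"
proof -
  have C: "0 \<le> C" using step[of 0] by linarith
  have inc: "\<bar>s (m + k) - s m\<bar> \<le> real k * C" for m k
  proof (induction k)
    case (Suc k)
    have "\<bar>s (m + Suc k) - s m\<bar> \<le> \<bar>s (Suc (m + k)) - s (m + k)\<bar> + \<bar>s (m + k) - s m\<bar>" by simp
    also have "\<dots> \<le> C + real k * C" using Suc step by (intro add_mono) auto
    finally show ?case by (simp add: algebra_simps)
  qed simp
  have sq: "filterlim floor_sqrt at_top sequentially"
  proof (subst filterlim_at_top, intro allI)
    fix Z
    show "\<forall>\<^sub>F N in sequentially. Z \<le> floor_sqrt N"
      using eventually_ge_at_top[of "Z^2"]
      by eventually_elim (metis le_floor_sqrt_iff power2_eq_square)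
  qed
  have 0: "(\<lambda>n. s (n^2) / real (n^2)) \<longlonglongrightarrow> 0"
    using lim by (subst filterlim_sequentially_Suc[symmetric])
  have 1: "(\<lambda>n. \<bar>s (n^2) / real (n^2)\<bar> + 2 * C / real n) \<longlonglongrightarrow> 0"
    using tendsto_add[OF tendsto_rabs[OF 0] tendsto_divide_0[OF tendsto_const[of "2*C"] filterlim_real_at_infinity_sequentially]]
    by (simp)
  have lim': "(\<lambda>N. \<bar>s ((floor_sqrt N)^2) / real ((floor_sqrt N)^2)\<bar> + 2 * C / real (floor_sqrt N)) \<longlonglongrightarrow> 0"
    by (rule filterlim_compose[OF 1 sq])
  show ?thesis
  proof (rule Lim_null_comparison[OF _ lim'])
    show "\<forall>\<^sub>F N in sequentially. norm (s N / real N)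
        \<le> \<bar>s ((floor_sqrt N)^2) / real ((floor_sqrt N)^2)\<bar> + 2 * C / real (floor_sqrt N)"
      using eventually_gt_at_top[of 0]
    proof eventually_elim
      case (elim N)
      define n where "n = floor_sqrt N"
      have n0: "n > 0" unfolding n_def using elim by simp
      have n1: "n^2 \<le> N" unfolding n_def by simp
      have n2: "N < (Suc n)^2" unfolding n_def using Suc_floor_sqrt_power2_gt by blast
      have n3: "N - n^2 \<le> 2 * n" using n2 by (simp add: power2_eq_square)
      have b: "\<bar>s N\<bar> \<le> \<bar>s (n^2)\<bar> + real (N - n^2) * C"
        using inc[of "n^2" "N - n^2"] n1 by simp
      have "real (N - n^2) \<le> 2 * real n" using n3 by linarith
      then have "\<bar>s (n^2)\<bar> + real (N - n^2) * C \<le> \<bar>s (n^2)\<bar> + (2 * real n) * C"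
        using C by (intro add_left_mono mult_right_mono)
      with b have a: "\<bar>s N\<bar> \<le> \<bar>s (n^2)\<bar> + (2 * real n) * C" by linarith
      have "\<bar>s N\<bar> / real N \<le> \<bar>s N\<bar> / real (n^2)"
        using n1 n0 elim by (intro divide_left_mono) (auto simp flip: of_nat_power of_nat_mult)
      also have "\<dots> \<le> (\<bar>s (n^2)\<bar> + (2 * real n) * C) / real (n^2)"
        using a n0 by (intro divide_right_mono) auto
      also have "\<dots> = \<bar>s (n^2) / real (n^2)\<bar> + 2 * C / real n"
        using n0 by (simp add: add_divide_distrib power2_eq_square)
      finally show ?case by (simp add: n_def)
    qed
  qed
qed

text \<open>Orthogonality bounds the second moment of the N-th partial sum by N C^2. Along the
  squares the averages then have summable second moments and tend to 0 almost surely; bounded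
  summands fill the gaps between squares.\<close>

lemma (in prob_space) bounded_orthogonal_SLLN:
  fixes f :: "nat \<Rightarrow> 'a \<Rightarrow> real"
  assumes [measurable]: "\<And>k. f k \<in> borel_measurable M"
    and bnd: "\<And>k. AE \<omega> in M. \<bar>f k \<omega>\<bar> \<le> C"
    and orth: "\<And>i k. i < k \<Longrightarrow> (\<integral>\<omega>. f i \<omega> * f k \<omega> \<partial>M) = 0"
  shows "AE \<omega> in M. (\<lambda>N. (\<Sum>k<N. f k \<omega>) / real N) \<longlonglongrightarrow> 0"
proof -
  define s where "s N \<omega> = (\<Sum>k<N. f k \<omega>)" for N \<omega>
  have [measurable]: "s N \<in> borel_measurable M" for N unfolding s_def by measurable
  have C: "0 \<le> C"
  proof -
    have "AE \<omega> in M. 0 \<le> C" using bnd[of 0] by eventually_elim linarith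
    then show ?thesis by simp
  qed
  have pint: "integrable M (\<lambda>\<omega>. f i \<omega> * f k \<omega>)" for i k
  proof (rule integrable_const_bound[of _ "C * C"])
    show "AE x in M. norm (f i x * f k x) \<le> C * C"
      using bnd[of i] bnd[of k] by eventually_elim (auto simp: abs_mult intro!: mult_mono)
  qed simp
  have orth': "(\<integral>\<omega>. f i \<omega> * f k \<omega> \<partial>M) = 0" if "i \<noteq> k" for i k
    using orth[of i k] orth[of k i] that by (cases "i < k") (auto simp: mult.commute)
  have sq: "integrable M (\<lambda>\<omega>. (s N \<omega>)^2) \<and> (\<integral>\<omega>. (s N \<omega>)^2 \<partial>M) \<le> real N * C^2" for N
  proof -
    have eq: "(s N \<omega>)^2 = (\<Sum>i<N. \<Sum>k<N. f i \<omega> * f k \<omega>)" for \<omega>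
      unfolding s_def power2_eq_square by (simp add: sum_product)
    have "(\<integral>\<omega>. (s N \<omega>)^2 \<partial>M) = (\<Sum>i<N. \<Sum>k<N. \<integral>\<omega>. f i \<omega> * f k \<omega> \<partial>M)"
      unfolding eq using pint by (simp add: Bochner_Integration.integral_sum)
    also have "\<dots> = (\<Sum>i<N. \<Sum>k<N. if k = i then \<integral>\<omega>. f i \<omega> * f i \<omega> \<partial>M else 0)"
      by (intro sum.cong refl) (auto simp: orth')
    also have "\<dots> = (\<Sum>i<N. \<integral>\<omega>. f i \<omega> * f i \<omega> \<partial>M)"
      by (simp add: sum.delta)
    also have "\<dots> \<le> (\<Sum>i<N. C^2)"
    proof (rule sum_mono)
      fix i
      have "AE \<omega> in M. f i \<omega> * f i \<omega> \<le> C^2"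
        using bnd[of i] by eventually_elim (metis abs_le_square_iff abs_of_nonneg C power2_eq_square)
      then have "(\<integral>\<omega>. f i \<omega> * f i \<omega> \<partial>M) \<le> (\<integral>\<omega>. C^2 \<partial>M)"
        using pint by (intro integral_mono_AE) auto
      then show "(\<integral>\<omega>. f i \<omega> * f i \<omega> \<partial>M) \<le> C^2" by (simp add: prob_space)
    qed
    finally show ?thesis unfolding eq using pint by auto
  qed
  \<comment> \<open>Along all N the second moments would only be bounded by C^2/N, which is not
    summable; along squares the bound is C^2/(n+1)^2. \<open>Suc n\<close> keeps the denominator
    nonzero.\<close>
  define g where "g n \<omega> = (s ((Suc n)^2) \<omega> / real ((Suc n)^2))^2" for n \<omega>
  have [measurable]: "g n \<in> borel_measurable M" for n unfolding g_def by measurable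
  have g: "(\<integral>\<^sup>+\<omega>. ennreal (g n \<omega>) \<partial>M) \<le> ennreal (C^2 * (1 / real ((Suc n)^2)))" for n
  proof -
    let ?N = "(Suc n)^2"
    have gi: "integrable M (g n)" unfolding g_def power_divide using sq[of ?N] by auto
    have "(\<integral>\<omega>. g n \<omega> \<partial>M) = (\<integral>\<omega>. (s ?N \<omega>)^2 \<partial>M) / (real ?N)^2"
      unfolding g_def power_divide by simp
    also have "\<dots> \<le> (real ?N * C^2) / (real ?N)^2"
      using sq[of ?N] by (intro divide_right_mono) auto
    also have "\<dots> = C^2 * (1 / real ?N)"
      unfolding power2_eq_square[of "real ?N"] by (simp del: of_nat_power of_nat_Suc)
    finally have "(\<integral>\<omega>. g n \<omega> \<partial>M) \<le> C^2 * (1 / real ?N)" .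
    then show ?thesis
      by (subst nn_integral_eq_integral[OF gi]) (auto simp: g_def[abs_def] simp del: of_nat_power of_nat_Suc intro!: ennreal_leI)
  qed
  have summ: "summable (\<lambda>n. C^2 * (1 / real ((Suc n)^2)))"
    using inverse_squares_sums by (intro summable_mult) (auto simp: sums_iff)
  have "(\<integral>\<^sup>+\<omega>. (\<Sum>n. ennreal (g n \<omega>)) \<partial>M) = (\<Sum>n. \<integral>\<^sup>+\<omega>. ennreal (g n \<omega>) \<partial>M)"
    by (intro nn_integral_suminf) simp
  also have "\<dots> \<le> (\<Sum>n. ennreal (C^2 * (1 / real ((Suc n)^2))))"
    using g by (intro suminf_le) auto
  also have "\<dots> < \<infinity>"
    using summ by (subst suminf_ennreal2) (auto)
  finally have "(\<integral>\<^sup>+\<omega>. (\<Sum>n. ennreal (g n \<omega>)) \<partial>M) \<noteq> \<infinity>" by simp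
  then have "AE \<omega> in M. (\<Sum>n. ennreal (g n \<omega>)) \<noteq> \<infinity>"
    by (intro nn_integral_PInf_AE) auto
  moreover have "AE \<omega> in M. \<forall>k. \<bar>f k \<omega>\<bar> \<le> C" using bnd by (simp add: AE_all_countable)
  ultimately show ?thesis
  proof eventually_elim
    case (elim \<omega>)
    have "summable (\<lambda>n. g n \<omega>)"
      using elim(1) by (intro summable_suminf_not_top) (auto simp: g_def)
    then have "(\<lambda>n. g n \<omega>) \<longlonglongrightarrow> 0" by (rule summable_LIMSEQ_zero)
    then have "(\<lambda>n. sqrt (g n \<omega>)) \<longlonglongrightarrow> 0" using tendsto_real_sqrt by fastforce
    then have "(\<lambda>n. s ((Suc n)^2) \<omega> / real ((Suc n)^2)) \<longlonglongrightarrow> 0"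
      unfolding g_def real_sqrt_abs by (rule tendsto_rabs_zero_cancel)
    then have "(\<lambda>N. s N \<omega> / real N) \<longlonglongrightarrow> 0"
      using elim(2) by (intro square_gap_bound[of "\<lambda>N. s N \<omega>" C]) (auto simp: s_def)
    then show ?case by (simp add: s_def)
  qed
qed

section \<open>Essential suprema and infima as countable suprema and infima\<close>

text \<open>Exhaustion: once the union over a countable J has maximal measure, a further
  \<open>B i\<close> can enlarge it only by a null set. The maximum is attained because countably
  many countable near-maximizers have a countable union.\<close>

lemma (in finite_measure) countable_ess_union:
  assumes meas: "\<And>i. i \<in> I \<Longrightarrow> B i \<in> sets M"
  obtains J where "countable J" "J \<subseteq> I" "\<And>i. i \<in> I \<Longrightarrow> measure M (B i - (\<Union>j\<in>J. B j)) = 0"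
proof -
  define \<C> where "\<C> = {J. countable J \<and> J \<subseteq> I}"
  define m where "m J = measure M (\<Union>j\<in>J. B j)" for J
  have U: "(\<Union>j\<in>J. B j) \<in> sets M" if "J \<in> \<C>" for J
    using that meas unfolding \<C>_def by (intro sets.countable_UN'') auto
  have bdd: "bdd_above (m ` \<C>)"
    by (rule bdd_aboveI[of _ "measure M (space M)"]) (auto simp: m_def intro: bounded_measure)
  have ne: "\<C> \<noteq> {}" unfolding \<C>_def by auto
  have "\<exists>J\<in>\<C>. (SUP J\<in>\<C>. m J) - inverse (real (Suc n)) < m J" for n
    using less_cSUP_iff[OF ne bdd, of "(SUP J\<in>\<C>. m J) - inverse (real (Suc n))"] by simp
  then obtain K where K: "\<And>n. K n \<in> \<C>" "\<And>n. (SUP J\<in>\<C>. m J) - inverse (real (Suc n)) < m (K n)"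
    by metis
  define J where "J = (\<Union>n. K n)"
  have J: "J \<in> \<C>" using K(1) unfolding J_def \<C>_def by auto
  have mono: "m A \<le> m B" if "A \<subseteq> B" "B \<in> \<C>" for A B
    unfolding m_def using that by (intro finite_measure_mono U) auto
  have Jmax: "(SUP J\<in>\<C>. m J) \<le> m J"
  proof (rule field_le_epsilon)
    fix e :: real assume "e > 0"
    then obtain n where "inverse (real (Suc n)) < e" using reals_Archimedean by blast
    moreover have "m (K n) \<le> m J" using J by (intro mono) (auto simp: J_def)
    ultimately show "(SUP J\<in>\<C>. m J) \<le> m J + e" using K(2)[of n] by linarith
  qed
  show ?thesis
  proof (rule that[of J])
    fix i assume i: "i \<in> I"
    have iJ: "insert i J \<in> \<C>" using J i by (auto simp: \<C>_def)
    have "measure M ((B i - (\<Union>j\<in>J. B j)) \<union> (\<Union>j\<in>J. B j)) = measure M (B i - (\<Union>j\<in>J. B j)) + m J"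
      unfolding m_def using U[OF J] meas[OF i] by (intro finite_measure_Union) auto
    also have "(B i - (\<Union>j\<in>J. B j)) \<union> (\<Union>j\<in>J. B j) = (\<Union>j\<in>insert i J. B j)" by auto
    finally have "m (insert i J) = measure M (B i - (\<Union>j\<in>J. B j)) + m J" unfolding m_def .
    moreover have "m (insert i J) \<le> m J" using cSUP_upper[OF iJ bdd] Jmax by linarith
    moreover have "0 \<le> measure M (B i - (\<Union>j\<in>J. B j))" by simp
    ultimately show "measure M (B i - (\<Union>j\<in>J. B j)) = 0" by linarith
  qed (use J in \<open>auto simp: \<C>_def\<close>)
qed

text \<open>Exhaustion is applied to the superlevel sets {q < f i}, giving one countable index set
  per rational q. Their union J serves all levels: if \<open>f i\<close> exceeded the supremum over
  J, a rational in between would witness it. In particular an essential supremum exists, so the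
  choice in \<open>family_esssup\<close> is meaningful.\<close>

lemma (in finite_measure) family_esssup_countable:
  fixes f :: "'i \<Rightarrow> 'a \<Rightarrow> ereal"
  assumes meas: "\<And>i. i \<in> I \<Longrightarrow> f i \<in> borel_measurable M"
  obtains J where "countable J" "J \<subseteq> I" "is_family_esssup M I f (\<lambda>\<omega>. SUP j\<in>J. f j \<omega>)"
proof -
  have "\<forall>q. \<exists>J. countable J \<and> J \<subseteq> I \<and> (\<forall>i\<in>I. measure M ({\<omega>\<in>space M. ereal (of_rat q) < f i \<omega>} -
      (\<Union>j\<in>J. {\<omega>\<in>space M. ereal (of_rat q) < f j \<omega>})) = 0)" (is "\<forall>q. \<exists>J. ?Q q J")
  proof
    fix q
    have "{\<omega>\<in>space M. ereal (of_rat q) < f i \<omega>} \<in> sets M" if "i \<in> I" for i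
      using meas[OF that] by measurable
    from countable_ess_union[of I "\<lambda>i. {\<omega>\<in>space M. ereal (of_rat q) < f i \<omega>}", OF this]
    obtain J where "countable J" "J \<subseteq> I" "\<And>i. i \<in> I \<Longrightarrow> measure M ({\<omega>\<in>space M. ereal (of_rat q) < f i \<omega>} -
      (\<Union>j\<in>J. {\<omega>\<in>space M. ereal (of_rat q) < f j \<omega>})) = 0" by blast
    then show "\<exists>J. ?Q q J" by (intro exI[of _ J]) simp
  qed
  from choice[OF this] obtain K where "\<forall>q. ?Q q (K q)" by blast
  then have K: "\<And>q. countable (K q)" "\<And>q. K q \<subseteq> I"
    "\<And>q i. i \<in> I \<Longrightarrow> measure M ({\<omega>\<in>space M. ereal (of_rat q) < f i \<omega>} -
      (\<Union>j\<in>K q. {\<omega>\<in>space M. ereal (of_rat q) < f j \<omega>})) = 0"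
    by blast+
  define J where "J = (\<Union>q. K q)"
  have J: "countable J" "J \<subseteq> I" using K unfolding J_def by auto
  have supm: "(\<lambda>\<omega>. SUP j\<in>J. f j \<omega>) \<in> borel_measurable M"
    using J meas by (intro borel_measurable_SUP) auto
  have le: "AE \<omega> in M. f i \<omega> \<le> (SUP j\<in>J. f j \<omega>)" if i: "i \<in> I" for i
  proof -
    have "AE \<omega> in M. \<omega> \<notin> {\<omega>\<in>space M. ereal (of_rat q) < f i \<omega>} -
      (\<Union>j\<in>K q. {\<omega>\<in>space M. ereal (of_rat q) < f j \<omega>})" for q
    proof (rule AE_not_in)
      have [measurable]: "j \<in> K q \<Longrightarrow> f j \<in> borel_measurable M" for j using K(2) meas by auto
      have [measurable]: "f i \<in> borel_measurable M" using i meas by auto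
      have "(\<Union>j\<in>K q. {\<omega>\<in>space M. ereal (of_rat q) < f j \<omega>}) \<in> sets M"
        using K(1)[of q] by (intro sets.countable_UN'') auto
      then show "{\<omega>\<in>space M. ereal (of_rat q) < f i \<omega>} -
          (\<Union>j\<in>K q. {\<omega>\<in>space M. ereal (of_rat q) < f j \<omega>}) \<in> null_sets M"
        using K(3)[OF i, of q] by (intro null_setsI) (auto simp: emeasure_eq_measure)
    qed
    then have "AE \<omega> in M. \<forall>q. \<omega> \<notin> {\<omega>\<in>space M. ereal (of_rat q) < f i \<omega>} -
      (\<Union>j\<in>K q. {\<omega>\<in>space M. ereal (of_rat q) < f j \<omega>})" by (simp add: AE_all_countable)
    with AE_space show ?thesis
    proof eventually_elim
      case (elim \<omega>)
      show ?case
      proof (rule ccontr)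
        assume "\<not> ?case"
        then obtain z where z: "(SUP j\<in>J. f j \<omega>) < ereal z" "ereal z < f i \<omega>"
          using ereal_dense2 by (metis not_le)
        obtain z' where z': "ereal z < ereal z'" "ereal z' < f i \<omega>" using ereal_dense2[OF z(2)] by blast
        obtain q where q: "z < of_rat q" "of_rat q < z'" using of_rat_dense z'(1) by auto
        have "ereal (of_rat q) < f i \<omega>" using q(2) z'(2) by (meson less_ereal.simps(1) order_less_trans)
        then obtain j where j: "j \<in> K q" "ereal (of_rat q) < f j \<omega>" using elim by blast
        have "f j \<omega> \<le> (SUP j\<in>J. f j \<omega>)" using j(1) by (intro SUP_upper) (auto simp: J_def)
        then have "ereal (of_rat q) < ereal z" using j(2) z(1) by order
        then show False using q(1) by simp
      qed
    qed
  qed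
  have "is_family_esssup M I f (\<lambda>\<omega>. SUP j\<in>J. f j \<omega>)"
    unfolding is_family_esssup_def
  proof (intro conjI ballI impI supm le)
    fix h assume "\<forall>i\<in>I. AE \<omega> in M. f i \<omega> \<le> h \<omega>"
    then have "AE \<omega> in M. \<forall>j\<in>J. f j \<omega> \<le> h \<omega>" using J by (subst AE_ball_countable) auto
    then show "AE \<omega> in M. (SUP j\<in>J. f j \<omega>) \<le> h \<omega>" by eventually_elim (simp add: SUP_le_iff)
  qed
  with J show ?thesis using that by blast
qed

lemma (in finite_measure) family_esssup:
  assumes "\<And>i. i \<in> I \<Longrightarrow> f i \<in> borel_measurable M"
  shows "is_family_esssup M I f (family_esssup M I f)"
  unfolding family_esssup_def
  by (rule family_esssup_countable[of I f]) (auto simp: assms intro: someI[of "is_family_esssup M I f"])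

lemma is_family_essinf_uminus:
  assumes "is_family_esssup M I (\<lambda>i \<omega>. - f i \<omega>) g"
  shows "is_family_essinf M I f (\<lambda>\<omega>. - g \<omega>)"
  unfolding is_family_essinf_def
proof (intro conjI ballI impI)
  show "(\<lambda>\<omega>. - g \<omega>) \<in> borel_measurable M" using assms by (auto simp: is_family_esssup_def)
  fix i assume "i \<in> I"
  then have "AE \<omega> in M. - f i \<omega> \<le> g \<omega>" using assms by (auto simp: is_family_esssup_def)
  then show "AE \<omega> in M. - g \<omega> \<le> f i \<omega>" by eventually_elim (simp add: ereal_uminus_le_reorder)
next
  fix h :: "'a \<Rightarrow> ereal" assume h: "h \<in> borel_measurable M" "\<forall>i\<in>I. AE \<omega> in M. h \<omega> \<le> f i \<omega>"
  then have "AE \<omega> in M. g \<omega> \<le> - h \<omega>"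
    using assms unfolding is_family_esssup_def
    by (auto dest!: bspec[of _ _ "\<lambda>\<omega>. - h \<omega>"])
  then show "AE \<omega> in M. h \<omega> \<le> - g \<omega>" by eventually_elim (metis ereal_minus_le_minus ereal_uminus_uminus)
qed

lemma (in finite_measure) family_essinf_countable:
  fixes f :: "'i \<Rightarrow> 'a \<Rightarrow> ereal"
  assumes meas: "\<And>i. i \<in> I \<Longrightarrow> f i \<in> borel_measurable M"
  obtains J where "countable J" "J \<subseteq> I" "is_family_essinf M I f (\<lambda>\<omega>. INF j\<in>J. f j \<omega>)"
proof -
  obtain J where "countable J" "J \<subseteq> I"
    and *: "is_family_esssup M I (\<lambda>i \<omega>. - f i \<omega>) (\<lambda>\<omega>. SUP j\<in>J. - f j \<omega>)"
    using family_esssup_countable[of I "\<lambda>i \<omega>. - f i \<omega>"] meas by auto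
  then show ?thesis using that[of J] is_family_essinf_uminus[OF *]
    by (simp add: ereal_SUP_uminus_eq)
qed

lemma (in finite_measure) family_essinf:
  assumes "\<And>i. i \<in> I \<Longrightarrow> f i \<in> borel_measurable M"
  shows "is_family_essinf M I f (family_essinf M I f)"
  unfolding family_essinf_def
  by (rule family_essinf_countable[of I f]) (auto simp: assms intro: someI[of "is_family_essinf M I f"])

lemma is_family_essinf_AE_unique:
  assumes "is_family_essinf M I f g" "is_family_essinf M I f h"
  shows "AE \<omega> in M. g \<omega> = h \<omega>"
proof -
  have "AE \<omega> in M. g \<omega> \<le> h \<omega>" "AE \<omega> in M. h \<omega> \<le> g \<omega>"
    using assms unfolding is_family_essinf_def by auto
  then show ?thesis by eventually_elim simp
qed

text \<open>Sets approximable from the algebra are closed under complements and countable unions. An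
  arbitrary finite measure is allowed because the later application uses the measure with density
  \<open>\<Lambda>\<close>.\<close>

lemma (in finite_measure) sigma_sets_approx:
  assumes A: "A \<in> sigma_sets (space M) \<A>"
    and alg: "algebra (space M) \<A>" and sub: "\<A> \<subseteq> sets M" and e: "e > 0"
  shows "\<exists>B\<in>\<A>. measure M (A - B \<union> (B - A)) < e"
proof -
  interpret algebra "space M" \<A> by (rule alg)
  have sM: "sigma_sets (space M) \<A> \<subseteq> sets M" using sub by (rule sets.sigma_sets_subset)
  show ?thesis using A e
  proof (induction arbitrary: e)
    case (Basic a)
    then show ?case by (intro bexI[of _ a]) auto
  next
    case Empty
    then show ?case by (intro bexI[of _ "{}"]) auto
  next
    case (Compl a)
    obtain B where B: "B \<in> \<A>" "measure M (a - B \<union> (B - a)) < e" using Compl by blast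
    have "a \<subseteq> space M" using Compl sM sets.sets_into_space by blast
    then have "(space M - a) - (space M - B) \<union> ((space M - B) - (space M - a)) = a - B \<union> (B - a)"
      using B(1) sets_into_space by auto
    then show ?case using B by (intro bexI[of _ "space M - B"]) auto
  next
    case (Union a)
    have am[measurable]: "a i \<in> sets M" for i using Union(1) sM by blast
    have "(\<lambda>n. measure M (\<Union>i\<le>n. a i)) \<longlonglongrightarrow> measure M (\<Union>n. \<Union>i\<le>n. a i)"
      by (intro finite_Lim_measure_incseq) (auto simp: incseq_def intro: order_trans)
    moreover have "(\<Union>n. \<Union>i\<le>n. a i) = (\<Union>i. a i)" by auto
    ultimately have "(\<lambda>n. measure M (\<Union>i\<le>n. a i)) \<longlonglongrightarrow> measure M (\<Union>i. a i)" by simp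
    then obtain n where n: "\<bar>measure M (\<Union>i\<le>n. a i) - measure M (\<Union>i. a i)\<bar> < e / 2"
      using Union(3) unfolding tendsto_iff dist_real_def eventually_sequentially
      by (metis half_gt_zero order_refl)
    \<comment> \<open>Cutting the union at n costs e/2; the other e/2 is shared by the n+1 sets that
      remain.\<close>
    define d where "d = e / (2 * real (Suc n))"
    have d: "d > 0" using Union(3) by (simp add: d_def)
    obtain B where B: "\<And>i. B i \<in> \<A>" "\<And>i. measure M (a i - B i \<union> (B i - a i)) < d"
      using Union(2)[OF d] by metis
    have Bm[measurable]: "B i \<in> sets M" for i using B(1) sub by auto
    let ?B = "\<Union>i\<le>n. B i"
    have "measure M ((\<Union>i. a i) - ?B \<union> (?B - (\<Union>i. a i)))
        \<le> measure M (((\<Union>i. a i) - (\<Union>i\<le>n. a i)) \<union> (\<Union>i\<le>n. a i - B i \<union> (B i - a i)))"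
      by (intro finite_measure_mono) (auto)
    also have "\<dots> \<le> measure M ((\<Union>i. a i) - (\<Union>i\<le>n. a i)) + measure M (\<Union>i\<le>n. a i - B i \<union> (B i - a i))"
      by (intro measure_Un_le) auto
    also have "measure M ((\<Union>i. a i) - (\<Union>i\<le>n. a i)) = measure M (\<Union>i. a i) - measure M (\<Union>i\<le>n. a i)"
      by (intro finite_measure_Diff) auto
    also have "\<dots> < e / 2" using n by linarith
    also have "measure M (\<Union>i\<le>n. a i - B i \<union> (B i - a i)) \<le> (\<Sum>i\<le>n. measure M (a i - B i \<union> (B i - a i)))"
      by (intro finite_measure_subadditive_finite) auto
    also have "\<dots> \<le> (\<Sum>i\<le>n. d)" using B(2) by (intro sum_mono less_imp_le) auto
    also have "\<dots> = e / 2" by (simp add: d_def field_simps)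
    finally show ?case using B(1) by (intro bexI[of _ ?B]) auto
  qed
qed

section \<open>From uniform L1 bounds to integrable envelopes\<close>

lemma is_family_essinf_lower:
  "is_family_essinf M I f g \<Longrightarrow> i \<in> I \<Longrightarrow> AE \<omega> in M. g \<omega> \<le> f i \<omega>"
  by (simp add: is_family_essinf_def)

lemma is_family_essinf_greatest:
  assumes "is_family_essinf M I f g" "h \<in> borel_measurable M" "\<And>i. i \<in> I \<Longrightarrow> AE \<omega> in M. h \<omega> \<le> f i \<omega>"
  shows "AE \<omega> in M. h \<omega> \<le> g \<omega>"
  using assms by (simp add: is_family_essinf_def)

lemma integrable_enn2real:
  assumes [measurable]: "X \<in> borel_measurable M" and X: "(\<integral>\<^sup>+\<omega>. X \<omega> \<partial>M) < ennreal e"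
  shows "integrable M (\<lambda>\<omega>. enn2real (X \<omega>))" and "(\<integral>\<omega>. enn2real (X \<omega>) \<partial>M) < e"
    and "AE \<omega> in M. ennreal (enn2real (X \<omega>)) = X \<omega>"
proof -
  have "(\<integral>\<^sup>+\<omega>. X \<omega> \<partial>M) \<noteq> \<infinity>" using X by (auto simp: top_unique)
  then have "AE \<omega> in M. X \<omega> \<noteq> \<infinity>" by (intro nn_integral_PInf_AE) auto
  then show ae: "AE \<omega> in M. ennreal (enn2real (X \<omega>)) = X \<omega>"
    by eventually_elim (simp add: less_top)
  have eq: "(\<integral>\<^sup>+\<omega>. ennreal (enn2real (X \<omega>)) \<partial>M) = (\<integral>\<^sup>+\<omega>. X \<omega> \<partial>M)"
    by (rule nn_integral_cong_AE[OF ae])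
  show i: "integrable M (\<lambda>\<omega>. enn2real (X \<omega>))"
    using X eq by (intro integrableI_nonneg) (auto simp: top_unique less_top[symmetric])
  have "ennreal (\<integral>\<omega>. enn2real (X \<omega>) \<partial>M) < ennreal e"
    using nn_integral_eq_integral[OF i] X eq by simp
  then show "(\<integral>\<omega>. enn2real (X \<omega>) \<partial>M) < e" by (rule ennreal_less_iff[THEN iffD1, rotated]) simp
qed

text \<open>The usable form of uniform L1 convergence: one real envelope of small mean for every i.
  It is the essential supremum at a large n, which bounds each member off a null set that may depend
  on i.\<close>

lemma (in prob_space) family_esssup_dominated:
  assumes g: "\<And>n i. i \<in> I \<Longrightarrow> g n i \<in> borel_measurable M" and I: "I \<noteq> {}"
    and lim: "tendsto_zero_L1 M (\<lambda>n. family_esssup M I (\<lambda>i \<omega>. ereal \<bar>g n i \<omega>\<bar>))" and e: "e > 0"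
  shows "\<exists>n d. integrable M d \<and> (\<integral>\<omega>. d \<omega> \<partial>M) < e \<and> (\<forall>i\<in>I. AE \<omega> in M. \<bar>g n i \<omega>\<bar> \<le> d \<omega>)"
proof -
  define S where "S n = family_esssup M I (\<lambda>i \<omega>. ereal \<bar>g n i \<omega>\<bar>)" for n
  have S: "is_family_esssup M I (\<lambda>i \<omega>. ereal \<bar>g n i \<omega>\<bar>) (S n)" for n
    unfolding S_def using g by (intro family_esssup) auto
  have [measurable]: "S n \<in> borel_measurable M" for n using S by (simp add: is_family_esssup_def)
  have "\<forall>\<^sub>F n in sequentially. (\<integral>\<^sup>+ \<omega>. e2ennreal \<bar>S n \<omega>\<bar> \<partial>M) < ennreal e"
    using lim e unfolding tendsto_zero_L1_def S_def by (intro order_tendstoD(2)) auto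
  then obtain n where n: "(\<integral>\<^sup>+ \<omega>. e2ennreal \<bar>S n \<omega>\<bar> \<partial>M) < ennreal e"
    by (auto simp: eventually_sequentially)
  define d where "d \<omega> = enn2real (e2ennreal \<bar>S n \<omega>\<bar>)" for \<omega>
  note d = integrable_enn2real[OF _ n, folded d_def]
  have "AE \<omega> in M. \<bar>g n i \<omega>\<bar> \<le> d \<omega>" if "i \<in> I" for i
  proof -
    have "AE \<omega> in M. ereal \<bar>g n i \<omega>\<bar> \<le> S n \<omega>" using S[of n] that by (simp add: is_family_esssup_def)
    moreover have "AE \<omega> in M. ennreal (d \<omega>) = e2ennreal \<bar>S n \<omega>\<bar>" by (rule d(3)) simp
    ultimately show ?thesis
    proof eventually_elim
      case (elim \<omega>)
      have "ereal \<bar>g n i \<omega>\<bar> \<le> \<bar>S n \<omega>\<bar>" using elim(1) abs_ge_self order_trans by (metis abs_ereal_ge0 ereal_less_eq(5) abs_ge_zero)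
      then have "e2ennreal (ereal \<bar>g n i \<omega>\<bar>) \<le> ennreal (d \<omega>)" unfolding elim(2) by (rule e2ennreal_mono)
      then show ?case by (simp add: d_def flip: ennreal.abs_eq)
    qed
  qed
  then show ?thesis using d(1,2) by (intro exI[of _ n] exI[of _ d]) auto
qed

lemma ignore_initial_terms:
  fixes f g :: "nat \<Rightarrow> real"
  assumes "\<And>k. K \<le> k \<Longrightarrow> f k = g k"
  shows "(\<lambda>N. (\<Sum>k=1..N. f k) / real N - (\<Sum>k=1..N. g k) / real N) \<longlonglongrightarrow> 0"
proof (rule Lim_transform_eventually)
  show "(\<lambda>N. (\<Sum>k=1..K. f k - g k) / real N) \<longlonglongrightarrow> 0"
    by (rule lim_const_over_n)
  show "\<forall>\<^sub>F N in sequentially. (\<Sum>k=1..K. f k - g k) / real N = (\<Sum>k=1..N. f k) / real N - (\<Sum>k=1..N. g k) / real N"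
    using eventually_ge_at_top[of K]
  proof eventually_elim
    case (elim N)
    have "(\<Sum>k=1..N. f k - g k) = (\<Sum>k=1..K. f k - g k)"
      using elim assms by (intro sum.mono_neutral_right) auto
    then show ?case by (simp only: sum_subtractf diff_divide_distrib[symmetric])
  qed
qed

text \<open>The essential supremum of an empty family is minus infinity almost surely, so its
  absolute value has infinite integral. This is how nonemptiness of the decision space is extracted
  from the convergence hypothesis.\<close>

lemma family_esssup_L1_limit_nonempty:
  assumes "prob_space M" "tendsto_zero_L1 M (\<lambda>n. family_esssup M I (f n))"
  shows "I \<noteq> {}"
proof
  assume I: "I = {}"
  interpret prob_space M by fact
  have "(\<integral>\<^sup>+ \<omega>. e2ennreal \<bar>family_esssup M I (f n) \<omega>\<bar> \<partial>M) = \<infinity>" for n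
  proof -
    have "is_family_esssup M I (f n) (family_esssup M I (f n))" by (rule family_esssup) (simp add: I)
    then have "AE \<omega> in M. family_esssup M I (f n) \<omega> \<le> - \<infinity>"
      unfolding is_family_esssup_def I by (auto dest!: bspec[of _ _ "\<lambda>_. - \<infinity>"])
    then have "AE \<omega> in M. e2ennreal \<bar>family_esssup M I (f n) \<omega>\<bar> = \<infinity>" by eventually_elim simp
    then have "(\<integral>\<^sup>+ \<omega>. e2ennreal \<bar>family_esssup M I (f n) \<omega>\<bar> \<partial>M) = (\<integral>\<^sup>+ \<omega>. \<infinity> \<partial>M)"
      by (rule nn_integral_cong_AE)
    then show ?thesis by (simp add: emeasure_space_1)
  qed
  then show False using assms(2) unfolding tendsto_zero_L1_def by (simp add: LIMSEQ_const_iff)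
qed

section \<open>Birkhoff's ergodic theorem\<close>

locale ergodic_system = prob_space +
  fixes T :: "'a \<Rightarrow> 'a"
  assumes T[measurable]: "T \<in> M \<rightarrow>\<^sub>M M"
    and distr_T: "distr M M T = M"
    and ergodic: "ergodic_transformation M T"
begin

lemma funpow_measurable[measurable]: "T ^^ k \<in> M \<rightarrow>\<^sub>M M"
  by (induction k) (auto intro: measurable_comp[OF _ T] simp: id_def)

lemma T_space: "\<omega> \<in> space M \<Longrightarrow> T \<omega> \<in> space M"
  using measurable_space[OF T] .

lemma distr_funpow: "distr M M (T ^^ k) = M"
proof (induction k)
  case (Suc k)
  have "distr M M (T ^^ Suc k) = distr (distr M M (T ^^ k)) M T"
    by (subst distr_distr) auto
  then show ?case unfolding Suc distr_T .
qed (simp add: id_def distr_id)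

lemma AE_funpow:
  assumes "AE \<omega> in M. P \<omega>"
  shows "AE \<omega> in M. P ((T ^^ k) \<omega>)"
  using AE_distrD[OF funpow_measurable[of k], where P = P] assms unfolding distr_funpow by blast

lemma integrable_funpow:
  fixes f :: "'a \<Rightarrow> real"
  assumes "integrable M f" shows "integrable M (\<lambda>\<omega>. f ((T ^^ k) \<omega>))"
  using integrable_distr[OF funpow_measurable, of k f] assms by (simp add: distr_funpow)

lemma integral_funpow:
  fixes f :: "'a \<Rightarrow> real"
  assumes [measurable]: "f \<in> borel_measurable M"
  shows "(\<integral>\<omega>. f ((T ^^ k) \<omega>) \<partial>M) = (\<integral>\<omega>. f \<omega> \<partial>M)"
  using integral_distr[OF funpow_measurable assms, of k] by (simp add: distr_funpow)

text \<open>Garsia's argument: \<open>P n = max {0, S\<^sub>1 f, \<dots>, S\<^sub>n f}\<close> satisfies a recursion from which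
  \<open>f \<ge> P (Suc n) - P n \<circ> T\<close> on \<open>{P (Suc n) > 0}\<close>.\<close>

lemma maximal_ergodic:
  fixes f :: "'a \<Rightarrow> real"
  assumes f: "integrable M f"
    and pos: "AE \<omega> in M. \<exists>n. 0 < (\<Sum>k<n. f ((T ^^ k) \<omega>))"
  shows "0 \<le> (\<integral>\<omega>. f \<omega> \<partial>M)"
proof -
  have [measurable]: "f \<in> borel_measurable M" using f by simp
  define P where "P = rec_nat (\<lambda>_. 0::real) (\<lambda>_ p \<omega>. max 0 (f \<omega> + p (T \<omega>)))"
  have P0: "P 0 = (\<lambda>_. 0)" and PS: "\<And>n. P (Suc n) = (\<lambda>\<omega>. max 0 (f \<omega> + P n (T \<omega>)))"
    by (simp_all add: P_def)
  have Pi: "integrable M (P n)" for n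
  proof (induction n)
    case (Suc n)
    have "integrable M (\<lambda>\<omega>. P n (T \<omega>))" using integrable_funpow[OF Suc, of 1] by simp
    then show ?case unfolding PS using f by auto
  qed (simp add: P0)
  have [measurable]: "P n \<in> borel_measurable M" for n using Pi by auto
  have PT: "(\<integral>\<omega>. P n (T \<omega>) \<partial>M) = (\<integral>\<omega>. P n \<omega> \<partial>M)" "integrable M (\<lambda>\<omega>. P n (T \<omega>))" for n
    using integral_funpow[of "P n" 1] integrable_funpow[OF Pi[of n], of 1] by simp_all
  have Pn: "0 \<le> P n \<omega>" for n \<omega> by (cases n) (auto simp: P0 PS)
  have Pmono: "P n \<omega> \<le> P (Suc n) \<omega>" for n \<omega>
  proof (induction n arbitrary: \<omega>)
    case 0 show ?case by (simp add: P0 Pn)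
  next
    case (Suc n) show ?case using Suc[of "T \<omega>"] by (subst (1 2) PS) (auto intro!: max.mono)
  qed
  have sum_le: "(\<Sum>k<n. f ((T ^^ k) \<omega>)) \<le> P n \<omega>" for n \<omega>
  proof (induction n arbitrary: \<omega>)
    case (Suc n)
    have "(\<Sum>k<Suc n. f ((T ^^ k) \<omega>)) = f \<omega> + (\<Sum>k<n. f ((T ^^ k) (T \<omega>)))"
      by (simp add: sum.lessThan_Suc_shift funpow_swap1 del: sum.lessThan_Suc)
    also have "\<dots> \<le> P (Suc n) \<omega>" using Suc[of "T \<omega>"] by (simp add: PS)
    finally show ?case .
  qed (simp add: P0)
  define g where "g n \<omega> = (if 0 < P n \<omega> then f \<omega> else 0)" for n \<omega>
  have [measurable]: "g n \<in> borel_measurable M" for n unfolding g_def by measurable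
  have gi: "integrable M (g n)" for n
    by (rule Bochner_Integration.integrable_bound[OF f]) (auto simp: g_def)
  have "0 \<le> (\<integral>\<omega>. g (Suc n) \<omega> \<partial>M)" for n
  proof -
    have "(\<integral>\<omega>. P (Suc n) \<omega> - P n (T \<omega>) \<partial>M) \<le> (\<integral>\<omega>. g (Suc n) \<omega> \<partial>M)"
    proof (rule integral_mono)
      show "P (Suc n) \<omega> - P n (T \<omega>) \<le> g (Suc n) \<omega>" for \<omega>
        using Pn[of n "T \<omega>"] by (auto simp: g_def PS max_def)
    qed (use Pi PT gi in auto)
    \<comment> \<open>Invariance of the measure removes T, and monotonicity of P in n makes the
      difference of the means nonnegative.\<close>
    moreover have "(\<integral>\<omega>. P (Suc n) \<omega> - P n (T \<omega>) \<partial>M) = (\<integral>\<omega>. P (Suc n) \<omega> \<partial>M) - (\<integral>\<omega>. P n \<omega> \<partial>M)"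
      using Pi PT by simp
    moreover have "(\<integral>\<omega>. P n \<omega> \<partial>M) \<le> (\<integral>\<omega>. P (Suc n) \<omega> \<partial>M)"
      using Pi Pmono by (intro integral_mono) auto
    ultimately show ?thesis by linarith
  qed
  \<comment> \<open>By \<open>pos\<close>, almost every point eventually lies in {P n > 0}, so the
    restrictions \<open>g\<close> of f recover f in the limit.\<close>
  moreover have "(\<lambda>n. \<integral>\<omega>. g (Suc n) \<omega> \<partial>M) \<longlonglongrightarrow> (\<integral>\<omega>. f \<omega> \<partial>M)"
  proof (rule integral_dominated_convergence[where w = "\<lambda>\<omega>. \<bar>f \<omega>\<bar>"])
    show "AE \<omega> in M. (\<lambda>n. g (Suc n) \<omega>) \<longlonglongrightarrow> f \<omega>"
      using pos
    proof eventually_elim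
      case (elim \<omega>)
      then obtain n where n: "0 < P n \<omega>" using sum_le by (meson less_le_trans)
      have "P n \<omega> \<le> P m \<omega>" if "n \<le> m" for m
        using Pmono that by (rule lift_Suc_mono_le)
      then have "0 < P (Suc m) \<omega>" if "n \<le> m" for m using n that le_SucI less_le_trans by metis
      then have "\<forall>m\<ge>n. g (Suc m) \<omega> = f \<omega>" by (simp add: g_def)
      then have "eventually (\<lambda>m. g (Suc m) \<omega> = f \<omega>) sequentially" unfolding eventually_sequentially by blast
      then show ?case by (rule tendsto_eventually)
    qed
  qed (use f in \<open>auto simp: g_def\<close>)
  ultimately show ?thesis by (meson LIMSEQ_le_const)
qed

text \<open>The set where the sums of f - c are unbounded above is invariant, hence of measure 0 or
  1. Measure 1 would let the maximal ergodic lemma give f - c a nonnegative mean, against c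
  exceeding the mean of f.\<close>

lemma birkhoff_bounded_above:
  fixes f :: "'a \<Rightarrow> real"
  assumes f: "integrable M f" and c: "(\<integral>\<omega>. f \<omega> \<partial>M) < c"
  shows "AE \<omega> in M. \<exists>K. \<forall>n. (\<Sum>k<n. f ((T ^^ k) \<omega>)) - c * real n \<le> K"
proof -
  have [measurable]: "f \<in> borel_measurable M" using f by simp
  define G where "G n \<omega> = (\<Sum>k<n. f ((T ^^ k) \<omega>)) - c * real n" for n \<omega>
  have [measurable]: "G n \<in> borel_measurable M" for n unfolding G_def by measurable
  have G_Suc: "G (Suc n) \<omega> = f \<omega> - c + G n (T \<omega>)" for n \<omega>
    by (simp add: G_def sum.lessThan_Suc_shift funpow_swap1 algebra_simps del: sum.lessThan_Suc)
  \<comment> \<open>The equivalence is exact, not only almost sure, because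
    \<open>ergodic_transformation\<close> speaks of sets equal to their preimage. Moving to
    \<open>T \<omega>\<close> changes G by the finite amount f - c, which a higher level K
    absorbs.\<close>
  have inv: "(\<forall>K::nat. \<exists>n. real K < G n (T \<omega>)) \<longleftrightarrow> (\<forall>K::nat. \<exists>n. real K < G n \<omega>)" for \<omega>
  proof safe
    fix K :: nat assume *: "\<forall>K::nat. \<exists>n. real K < G n (T \<omega>)"
    obtain K' :: nat where "real K + \<bar>f \<omega> - c\<bar> < real K'" using reals_Archimedean2 by blast
    moreover obtain n where "real K' < G n (T \<omega>)" using * by blast
    ultimately have "real K < G (Suc n) \<omega>" unfolding G_Suc by linarith
    then show "\<exists>n. real K < G n \<omega>" by blast
  next
    fix K :: nat assume *: "\<forall>K::nat. \<exists>n. real K < G n \<omega>"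
    obtain K' :: nat where K': "real K + \<bar>f \<omega> - c\<bar> < real K'" using reals_Archimedean2 by blast
    obtain n where n: "real K' < G n \<omega>" using * by blast
    have "n \<noteq> 0" using n by (intro notI) (simp add: G_def)
    then obtain m where "n = Suc m" using not0_implies_Suc by blast
    with n have "real K' < f \<omega> - c + G m (T \<omega>)" by (simp add: G_Suc)
    with K' have "real K < G m (T \<omega>)" by linarith
    then show "\<exists>n. real K < G n (T \<omega>)" by blast
  qed
  define E where "E = {\<omega>\<in>space M. \<forall>K::nat. \<exists>n. real K < G n \<omega>}"
  have E[measurable]: "E \<in> sets M" unfolding E_def by measurable
  have "T -` E \<inter> space M = E" unfolding E_def using inv T_space by auto
  then have "measure M E = 0 \<or> measure M E = 1"
    using ergodic E unfolding ergodic_transformation_def by blast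
  moreover have "measure M E \<noteq> 1"
  proof
    assume "measure M E = 1"
    then have "AE \<omega> in M. \<omega> \<in> E" using E by (simp add: prob_eq_1)
    then have "AE \<omega> in M. \<exists>n. 0 < (\<Sum>k<n. f ((T ^^ k) \<omega>) - c)"
    proof eventually_elim
      case (elim \<omega>)
      then obtain n where "real 0 < G n \<omega>" unfolding E_def by blast
      then show ?case by (intro exI[of _ n]) (simp add: G_def sum_subtractf mult.commute)
    qed
    from maximal_ergodic[OF _ this] f have "0 \<le> (\<integral>\<omega>. f \<omega> - c \<partial>M)" by simp
    then show False using f c by (simp add: prob_space)
  qed
  ultimately have "E \<in> null_sets M" using E by (auto simp: emeasure_eq_measure)
  then have "AE \<omega> in M. \<omega> \<notin> E" by (rule AE_not_in)
  with AE_space show ?thesis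
  proof eventually_elim
    case (elim \<omega>)
    then obtain K :: nat where "\<forall>n. \<not> real K < G n \<omega>" unfolding E_def by blast
    then show ?case unfolding G_def by (intro exI[of _ "real K"]) (simp add: not_less)
  qed
qed

text \<open>With d strictly between the mean and c, the sums are at most K + d n, and K is absorbed
  once (c - d) n exceeds it.\<close>

lemma birkhoff_eventually_le:
  fixes f :: "'a \<Rightarrow> real"
  assumes f: "integrable M f" and c: "(\<integral>\<omega>. f \<omega> \<partial>M) < c"
  shows "AE \<omega> in M. \<forall>\<^sub>F n in sequentially. (\<Sum>k<n. f ((T ^^ k) \<omega>)) / real n \<le> c"
proof -
  obtain d where d: "(\<integral>\<omega>. f \<omega> \<partial>M) < d" "d < c" using c dense by blast
  from birkhoff_bounded_above[OF f d(1)] show ?thesis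
  proof eventually_elim
    case (elim \<omega>)
    then obtain K where K: "\<And>n. (\<Sum>k<n. f ((T ^^ k) \<omega>)) - d * real n \<le> K" by blast
    obtain N :: nat where N: "K / (c - d) < real N" using reals_Archimedean2 by blast
    show ?case
      using eventually_ge_at_top[of "max 1 N"]
    proof eventually_elim
      case (elim n)
      have "K < (c - d) * real N" using N d by (simp add: field_simps)
      also have "\<dots> \<le> (c - d) * real n" using elim d by (intro mult_left_mono) auto
      finally have "(\<Sum>k<n. f ((T ^^ k) \<omega>)) \<le> c * real n" using K[of n] by (simp add: algebra_simps)
      then show ?case using elim by (simp add: field_simps)
    qed
  qed
qed

theorem birkhoff:
  fixes f :: "'a \<Rightarrow> real"
  assumes f: "integrable M f"
  shows "AE \<omega> in M. (\<lambda>N. (\<Sum>k=1..N. f ((T ^^ k) \<omega>)) / real N) \<longlonglongrightarrow> (\<integral>\<omega>. f \<omega> \<partial>M)"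
proof -
  have "AE \<omega> in M. (\<lambda>N. (\<Sum>k<N. f ((T ^^ k) \<omega>)) / real N - (\<integral>\<omega>. f \<omega> \<partial>M)) \<longlonglongrightarrow> 0"
  proof (rule AE_tendsto_zeroI)
    fix e :: real assume e: "0 < e"
    have "AE \<omega> in M. \<forall>\<^sub>F n in sequentially. (\<Sum>k<n. f ((T ^^ k) \<omega>)) / real n \<le> (\<integral>\<omega>. f \<omega> \<partial>M) + e"
      using e by (intro birkhoff_eventually_le f) simp
    moreover have "AE \<omega> in M. \<forall>\<^sub>F n in sequentially. (\<Sum>k<n. - f ((T ^^ k) \<omega>)) / real n \<le> - (\<integral>\<omega>. f \<omega> \<partial>M) + e"
      using e f by (intro birkhoff_eventually_le) auto
    ultimately show "AE \<omega> in M. \<forall>\<^sub>F n in sequentially.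
        \<bar>(\<Sum>k<n. f ((T ^^ k) \<omega>)) / real n - (\<integral>\<omega>. f \<omega> \<partial>M)\<bar> \<le> e"
    proof eventually_elim
      case (elim \<omega>)
      then show ?case by eventually_elim (auto simp: sum_negf abs_le_iff)
    qed
  qed
  \<comment> \<open>Sums over 0..N-1 started at \<open>T \<omega>\<close> are sums over 1..N at
    \<open>\<omega>\<close>, matching strategies that start at time 1.\<close>
  then have "AE \<omega> in M. (\<lambda>N. (\<Sum>k<N. f ((T ^^ k) ((T ^^ 1) \<omega>))) / real N - (\<integral>\<omega>. f \<omega> \<partial>M)) \<longlonglongrightarrow> 0"
    by (rule AE_funpow)
  then show ?thesis
  proof eventually_elim
    case (elim \<omega>)
    have "(\<Sum>k=1..N. f ((T ^^ k) \<omega>)) = (\<Sum>k<N. f ((T ^^ k) ((T ^^ 1) \<omega>)))" for N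
      by (simp add: sum.atLeast1_atMost_eq funpow_swap1)
    with elim show ?case by (simp add: LIM_zero_iff)
  qed
qed

end

section \<open>The fields generated by an invertible system\<close>

lemma (in prob_space) finite_measure_subalgebraI:
  assumes "subalgebra M F" shows "finite_measure_subalgebra M F"
  by unfold_locales (use assms in \<open>auto simp: subalgebra_def emeasure_finite\<close>)

lemma (in sigma_finite_subalgebra) real_cond_exp_abs_le:
  assumes [measurable]: "integrable M h" "integrable M g"
    and le: "AE \<omega> in M. \<bar>h \<omega>\<bar> \<le> g \<omega>"
  shows "AE \<omega> in M. \<bar>real_cond_exp M F h \<omega>\<bar> \<le> real_cond_exp M F g \<omega>"
proof -
  have "AE \<omega> in M. real_cond_exp M F h \<omega> \<le> real_cond_exp M F g \<omega>"
    using le by (intro real_cond_exp_mono assms) (auto elim!: eventually_mono)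
  moreover have "AE \<omega> in M. real_cond_exp M F (\<lambda>\<omega>. (-1) * g \<omega>) \<omega> \<le> real_cond_exp M F h \<omega>"
    using le assms by (intro real_cond_exp_mono) (auto elim!: eventually_mono)
  moreover have "AE \<omega> in M. real_cond_exp M F (\<lambda>\<omega>. (-1) * g \<omega>) \<omega> = (-1) * real_cond_exp M F g \<omega>"
    by (intro real_cond_exp_cmult assms)
  ultimately show ?thesis by eventually_elim linarith
qed

locale invertible_ergodic_system = prob_space +
  fixes T :: "'a \<Rightarrow> 'a"
  assumes invertible: "invertible_measure_preserving M T"
    and ergodic_T: "ergodic_transformation M T"

sublocale invertible_ergodic_system \<subseteq> ergodic_system M T
  by unfold_locales (use invertible ergodic_T in \<open>auto simp: invertible_measure_preserving_def\<close>)

context invertible_ergodic_system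
begin

lemma T_bij: "bij_betw T (space M) (space M)"
  and inv_measurable[measurable]: "the_inv_into (space M) T \<in> M \<rightarrow>\<^sub>M M"
  using invertible by (auto simp: invertible_measure_preserving_def)

lemma T_pow_nat[simp]: "T_pow M T (int k) = T ^^ k"
  by (simp add: T_pow_def)

lemma T_pow_0[simp]: "T_pow M T 0 = (\<lambda>\<omega>. \<omega>)"
  by (simp add: T_pow_def id_def)

lemma T_pow_measurable[measurable]: "T_pow M T k \<in> M \<rightarrow>\<^sub>M M"
proof -
  have "the_inv_into (space M) T ^^ n \<in> M \<rightarrow>\<^sub>M M" for n
    by (induction n) (auto intro: measurable_comp[OF _ inv_measurable] simp: id_def)
  then show ?thesis by (simp add: T_pow_def)
qed

lemma T_pow_space: "\<omega> \<in> space M \<Longrightarrow> T_pow M T k \<omega> \<in> space M"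
  using measurable_space[OF T_pow_measurable] .

lemma T_pow_Suc:
  assumes \<omega>: "\<omega> \<in> space M"
  shows "T_pow M T (k + 1) \<omega> = T (T_pow M T k \<omega>)"
proof (cases "0 \<le> k")
  case True
  then show ?thesis by (simp add: T_pow_def nat_add_distrib)
next
  case False
  let ?S = "the_inv_into (space M) T"
  obtain j where j: "nat (- k) = Suc j" using False by (cases "nat (- k)") auto
  \<comment> \<open>At \<open>k + 1 = 0\<close> the definition of \<open>T_pow\<close> switches from
    iterates of the inverse to iterates of T.\<close>
  have S: "(?S ^^ j) \<omega> = T_pow M T (k + 1) \<omega>"
  proof (cases "k + 1 = 0")
    case False
    have "nat (- (k + 1)) = j" using j by simp
    then show ?thesis using False \<open>\<not> 0 \<le> k\<close> by (simp add: T_pow_def)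
  next
    case True
    then have "k = -1" by simp
    then have "j = 0" using j by simp
    then show ?thesis using True by simp
  qed
  have "T (T_pow M T k \<omega>) = T (?S ((?S ^^ j) \<omega>))" using False j by (simp add: T_pow_def)
  also have "\<dots> = (?S ^^ j) \<omega>"
    unfolding S using T_bij T_pow_space[OF \<omega>]
    by (intro f_the_inv_into_f) (auto simp: bij_betw_def)
  finally show ?thesis by (simp add: S)
qed

lemma T_pow_add:
  assumes \<omega>: "\<omega> \<in> space M"
  shows "T_pow M T (m + n) \<omega> = T_pow M T m (T_pow M T n \<omega>)"
proof (induction m rule: int_induct[of _ 0])
  case (step1 i)
  have "T_pow M T (i + n + 1) \<omega> = T (T_pow M T (i + n) \<omega>)" by (rule T_pow_Suc[OF \<omega>])
  also have "\<dots> = T (T_pow M T i (T_pow M T n \<omega>))" using step1 by simp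
  also have "\<dots> = T_pow M T (i + 1) (T_pow M T n \<omega>)"
    by (rule T_pow_Suc[OF T_pow_space[OF \<omega>], symmetric])
  finally show ?case by (simp add: algebra_simps)
next
  case (step2 i)
  \<comment> \<open>In the downward step the two sides are compared after applying T, which is
    injective on the space.\<close>
  have "T (T_pow M T (i - 1 + n) \<omega>) = T_pow M T (i + n) \<omega>"
    using T_pow_Suc[OF \<omega>, of "i - 1 + n"] by (simp add: algebra_simps)
  also have "\<dots> = T (T_pow M T (i - 1) (T_pow M T n \<omega>))"
    using step2 T_pow_Suc[OF T_pow_space[OF \<omega>], of "i - 1" n] by simp
  finally show ?case
    using T_bij T_pow_space \<omega> by (auto simp: bij_betw_def dest!: inj_onD)
qed simp

lemma T_pow_inverse: "\<omega> \<in> space M \<Longrightarrow> m + n = 0 \<Longrightarrow> T_pow M T m (T_pow M T n \<omega>) = \<omega>"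
  by (simp flip: T_pow_add)

text \<open>Rewrites the images that define \<open>T_image\<close> as preimages under a measurable
  map, so that pullbacks reduce to the group law \<open>T_pow_add\<close>.\<close>

lemma T_pow_image:
  assumes "A \<subseteq> space M"
  shows "T_pow M T k ` A = T_pow M T (- k) -` A \<inter> space M"
proof (intro equalityI subsetI)
  fix \<omega> assume "\<omega> \<in> T_pow M T k ` A"
  then show "\<omega> \<in> T_pow M T (- k) -` A \<inter> space M"
    using assms by (auto simp: T_pow_inverse T_pow_space subsetD)
next
  fix \<omega> assume "\<omega> \<in> T_pow M T (- k) -` A \<inter> space M"
  then show "\<omega> \<in> T_pow M T k ` A"
    by (intro image_eqI[of _ _ "T_pow M T (- k) \<omega>"]) (auto simp: T_pow_inverse)
qed

lemma distr_T_pow: "distr M M (T_pow M T k) = M"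
proof (cases "0 \<le> k")
  case True
  then show ?thesis using distr_funpow[of "nat k"] by (simp add: T_pow_def)
next
  case False
  \<comment> \<open>For negative k, M is first written as its own image under the positive power
    T^{-k}; the composition is the identity.\<close>
  have "distr M M (T_pow M T k) = distr (distr M M (T_pow M T (- k))) M (T_pow M T k)"
    using False distr_funpow[of "nat (- k)"] by (simp add: T_pow_def)
  also have "\<dots> = distr M M (T_pow M T k \<circ> T_pow M T (- k))"
    by (rule distr_distr) auto
  also have "\<dots> = distr M M (\<lambda>\<omega>. \<omega>)" by (rule distr_cong) (auto simp: T_pow_inverse)
  finally show ?thesis by (simp add: distr_id)
qed

lemma integrable_T_pow:
  fixes f :: "'a \<Rightarrow> real"
  assumes "integrable M f" shows "integrable M (\<lambda>\<omega>. f (T_pow M T k \<omega>))"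
  using integrable_distr[OF T_pow_measurable, of k f] assms by (simp add: distr_T_pow)

lemma space_T_image[simp]: "space (T_image M T k F) = space M"
  and space_obs_field[simp]: "space (obs_field M T Y K) = space M"
  and space_field_join[simp]: "space (field_join M F G) = space M"
  and space_remote_field[simp]: "space (remote_field M T Y X) = space M"
  by (simp_all add: T_image_def obs_field_def field_join_def remote_field_def space_measure_of_conv)

lemma subalgebra_sets_Pow: "subalgebra M F \<Longrightarrow> sets F \<subseteq> Pow (space M)"
  using sets.space_closed[of F] by (simp add: subalgebra_def)

lemma subalgebra_T_image:
  assumes "subalgebra M F" shows "subalgebra M (T_image M T k F)"
proof -
  have F: "sets F \<subseteq> sets M" using assms by (simp add: subalgebra_def)
  have "T_pow M T k ` A \<in> sets M" if "A \<in> sets F" for A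
    using that F sets.sets_into_space[of A M] by (subst T_pow_image) (auto intro!: measurable_sets[OF T_pow_measurable])
  then have *: "{T_pow M T k ` A | A. A \<in> sets F} \<subseteq> sets M" by blast
  then have "{T_pow M T k ` A | A. A \<in> sets F} \<subseteq> Pow (space M)" using sets.space_closed by blast
  then have "sets (T_image M T k F) \<subseteq> sets M"
    unfolding T_image_def by (subst sets_measure_of) (assumption, rule sets.sigma_sets_subset[OF *])
  then show ?thesis by (simp add: subalgebra_def)
qed

lemma T_image_generators:
  assumes "subalgebra M F"
  shows "{T_pow M T k ` A | A. A \<in> sets F} \<subseteq> Pow (space M)"
    and "A \<in> sets F \<Longrightarrow> T_pow M T k ` A \<in> sets (T_image M T k F)"
proof -
  have "A \<subseteq> space M" if "A \<in> sets F" for A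
    using assms that sets.sets_into_space[of A F] by (simp add: subalgebra_def)
  then show *: "{T_pow M T k ` A | A. A \<in> sets F} \<subseteq> Pow (space M)" using T_pow_space by blast
  show "A \<in> sets F \<Longrightarrow> T_pow M T k ` A \<in> sets (T_image M T k F)"
    unfolding T_image_def by (subst sets_measure_of[OF *]) auto
qed

text \<open>On generators: T^n pulls T^m A back to T^{m-n} A.\<close>

lemma T_pow_measurable_T_image:
  assumes F: "subalgebra M F"
  shows "T_pow M T n \<in> T_image M T (m - n) F \<rightarrow>\<^sub>M T_image M T m F"
proof -
  have "T_pow M T n \<in> T_image M T (m - n) F \<rightarrow>\<^sub>M sigma (space M) {T_pow M T m ` A | A. A \<in> sets F}"
  proof (rule measurable_measure_of[OF T_image_generators(1)[OF F]])
    fix y assume "y \<in> {T_pow M T m ` A | A. A \<in> sets F}"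
    then obtain A where A: "A \<in> sets F" "y = T_pow M T m ` A" by blast
    then have AM: "A \<subseteq> space M" using F sets.sets_into_space[of A F] by (simp add: subalgebra_def)
    have "T_pow M T n -` y \<inter> space M = T_pow M T (m - n) ` A"
      unfolding A(2) T_pow_image[OF AM] using T_pow_space T_pow_add[of _ "- m" n] by auto
    then show "T_pow M T n -` y \<inter> space (T_image M T (m - n) F) \<in> sets (T_image M T (m - n) F)"
      using T_image_generators(2)[OF F A(1), of "m - n"] by simp
  qed (use T_pow_space in auto)
  then show ?thesis unfolding T_image_def[of _ _ m] .
qed

lemma sets_T_image_mono:
  assumes F: "subalgebra M F" and le: "sets F \<subseteq> sets (T_image M T n F)"
  shows "sets (T_image M T k F) \<subseteq> sets (T_image M T (k + n) F)"
proof -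
  have "{T_pow M T k ` A | A. A \<in> sets F} \<subseteq> sets (T_image M T (k + n) F)"
  proof safe
    fix A assume A: "A \<in> sets F"
    then have AM: "A \<subseteq> space M" using F sets.sets_into_space[of A F] by (simp add: subalgebra_def)
    show "T_pow M T k ` A \<in> sets (T_image M T (k + n) F)"
    proof -
      have "A \<in> sets (T_image M T n F)" using A le by blast
      from measurable_sets[OF T_pow_measurable_T_image[OF F, of "- k" n] this]
      show ?thesis unfolding T_pow_image[OF AM] by (simp add: add.commute)
    qed
  qed
  from sets.sigma_sets_subset[OF this] show ?thesis
    unfolding T_image_def[of _ _ k] sets_measure_of[OF T_image_generators(1)[OF F]] space_T_image .
qed

lemma obs_field_generators:
  assumes Y: "subalgebra M Y"
  shows "(\<Union>k\<in>K. sets (T_image M T (- k) Y)) \<subseteq> Pow (space M)"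
  by (intro UN_least subalgebra_sets_Pow subalgebra_T_image Y)

lemma sets_T_image_obs_field:
  assumes Y: "subalgebra M Y" and "k \<in> K"
  shows "sets (T_image M T (- k) Y) \<subseteq> sets (obs_field M T Y K)"
  unfolding obs_field_def sets_measure_of[OF obs_field_generators[OF Y]] using assms(2) by auto

lemma sets_obs_field_mono:
  assumes Y: "subalgebra M Y" and "K \<subseteq> L"
  shows "sets (obs_field M T Y K) \<subseteq> sets (obs_field M T Y L)"
  unfolding obs_field_def sets_measure_of[OF obs_field_generators[OF Y]]
  using assms(2) by (intro sigma_sets_mono') auto

lemma subalgebra_obs_field:
  assumes Y: "subalgebra M Y"
  shows "subalgebra M (obs_field M T Y K)"
  unfolding subalgebra_def
proof
  show "sets (obs_field M T Y K) \<subseteq> sets M"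
    unfolding obs_field_def sets_measure_of[OF obs_field_generators[OF Y]]
    using subalgebra_T_image[OF Y] by (intro sets.sigma_sets_subset) (auto simp: subalgebra_def)
qed simp

text \<open>T^n pulls T^{-k}Y back to T^{-(k+n)}Y, so observation times move by +n. This carries
  decisions between time windows in both directions.\<close>

lemma T_pow_measurable_obs_field:
  assumes Y: "subalgebra M Y" and KL: "\<And>k. k \<in> K \<Longrightarrow> k + n \<in> L"
  shows "T_pow M T n \<in> obs_field M T Y L \<rightarrow>\<^sub>M obs_field M T Y K"
proof -
  have "T_pow M T n \<in> obs_field M T Y L \<rightarrow>\<^sub>M sigma (space M) (\<Union>k\<in>K. sets (T_image M T (- k) Y))"
  proof (rule measurable_measure_of[OF obs_field_generators[OF Y]])
    fix y assume "y \<in> (\<Union>k\<in>K. sets (T_image M T (- k) Y))"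
    then obtain k where k: "k \<in> K" "y \<in> sets (T_image M T (- k) Y)" by blast
    have "T_pow M T n -` y \<inter> space (T_image M T (- k - n) Y) \<in> sets (T_image M T (- k - n) Y)"
      by (rule measurable_sets[OF T_pow_measurable_T_image[OF Y] k(2)])
    moreover have "sets (T_image M T (- k - n) Y) \<subseteq> sets (obs_field M T Y L)"
      using sets_T_image_obs_field[OF Y KL[OF k(1)]] by simp
    ultimately show "T_pow M T n -` y \<inter> space (obs_field M T Y L) \<in> sets (obs_field M T Y L)"
      by auto
  qed (use T_pow_space in auto)
  then show ?thesis unfolding obs_field_def[of _ _ _ K] .
qed

lemma field_join_generators:
  assumes "subalgebra M F" "subalgebra M G"
  shows "sets F \<union> sets G \<subseteq> Pow (space M)"
  by (intro Un_least subalgebra_sets_Pow assms)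

lemma subalgebra_field_join:
  assumes F: "subalgebra M F" and G: "subalgebra M G"
  shows "subalgebra M (field_join M F G)"
    and "sets F \<subseteq> sets (field_join M F G)" "sets G \<subseteq> sets (field_join M F G)"
proof -
  have eq: "sets (field_join M F G) = sigma_sets (space M) (sets F \<union> sets G)"
    unfolding field_join_def by (rule sets_measure_of[OF field_join_generators[OF F G]])
  have "sigma_sets (space M) (sets F \<union> sets G) \<subseteq> sets M"
    using F G by (intro sets.sigma_sets_subset) (auto simp: subalgebra_def)
  then show "subalgebra M (field_join M F G)"
    unfolding subalgebra_def eq by (simp add: field_join_def space_measure_of_conv)
  show "sets F \<subseteq> sets (field_join M F G)" "sets G \<subseteq> sets (field_join M F G)"
    unfolding eq by auto
qed

lemma sets_field_join_least:
  assumes F: "subalgebra M F" and G: "subalgebra M G" and H: "subalgebra M H"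
    and "sets F \<subseteq> sets H" "sets G \<subseteq> sets H"
  shows "sets (field_join M F G) \<subseteq> sets H"
  unfolding field_join_def sets_measure_of[OF field_join_generators[OF F G]]
  using assms sets.sigma_sets_subset[of "sets F \<union> sets G" H] by (simp add: subalgebra_def)

lemma measurable_field_join:
  assumes F: "subalgebra M F" and G: "subalgebra M G"
    and "f \<in> H \<rightarrow>\<^sub>M F" "f \<in> H \<rightarrow>\<^sub>M G"
  shows "f \<in> H \<rightarrow>\<^sub>M field_join M F G"
  unfolding field_join_def
  using assms measurable_space[OF assms(3)] measurable_sets[OF assms(3)] measurable_sets[OF assms(4)]
  by (intro measurable_measure_of field_join_generators) (auto simp: subalgebra_def)

lemma subalgebra_remote_field:
  assumes Y: "subalgebra M Y" and X: "subalgebra M X"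
  shows "subalgebra M (remote_field M T Y X)"
proof -
  let ?J = "\<lambda>k. field_join M (obs_field M T Y {..0}) (T_image M T k X)"
  have "subalgebra M (?J 1)"
    by (intro subalgebra_field_join subalgebra_obs_field Y subalgebra_T_image X)
  then have *: "(\<Inter>k\<in>{1::int..}. sets (?J k)) \<subseteq> sets M" by (auto simp: subalgebra_def)
  then have "(\<Inter>k\<in>{1::int..}. sets (?J k)) \<subseteq> Pow (space M)" using sets.space_closed by blast
  then show ?thesis unfolding subalgebra_def remote_field_def
    using sets.sigma_sets_subset[OF *] by (simp add: sets_measure_of space_measure_of_conv)
qed

section \<open>The two-sided filtration\<close>

definition past_field :: "'a measure \<Rightarrow> 'a measure \<Rightarrow> int \<Rightarrow> 'a measure" where
  "past_field Y X j = field_join M (obs_field M T Y {..0}) (T_image M T (- j) X)"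

text \<open>Monotonicity in j is the inclusion \<open>le\<close> transported by T^{-j}. For the
  shift, T^{-1} pulls the observations up to time 0 back to those up to time -1, and T^{-(j+1)}X
  back to T^{-j}X; both lie in the field of index j.\<close>

lemma past_field:
  assumes Y: "subalgebra M Y" and X: "subalgebra M X" and le: "sets X \<subseteq> sets (T_image M T (- 1) X)"
  shows "subalgebra M (past_field Y X j)"
    and "sets (past_field Y X j) \<subseteq> sets (past_field Y X (j + 1))"
    and "T_pow M T (- 1) \<in> past_field Y X j \<rightarrow>\<^sub>M past_field Y X (j + 1)"
proof -
  note * = subalgebra_obs_field[OF Y] subalgebra_T_image[OF X]
  show sub: "subalgebra M (past_field Y X j)" for j
    unfolding past_field_def by (intro subalgebra_field_join *)
  have XX: "sets (T_image M T (- j) X) \<subseteq> sets (T_image M T (- (j + 1)) X)"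
    using sets_T_image_mono[OF X le, of "- j"] by simp
  show "sets (past_field Y X j) \<subseteq> sets (past_field Y X (j + 1))"
    using sub[of "j + 1"] subalgebra_field_join(2,3)[OF *] XX unfolding past_field_def
    by (intro sets_field_join_least * ) blast+
  have "T_pow M T (- 1) \<in> obs_field M T Y {..0} \<rightarrow>\<^sub>M obs_field M T Y {..0}"
    by (intro T_pow_measurable_obs_field[OF Y]) auto
  moreover have "T_pow M T (- 1) \<in> T_image M T (- j) X \<rightarrow>\<^sub>M T_image M T (- (j + 1)) X"
    using T_pow_measurable_T_image[OF X, of "-1" "- (j + 1)"] by simp
  moreover have "subalgebra (past_field Y X j) (obs_field M T Y {..0})"
    "subalgebra (past_field Y X j) (T_image M T (- j) X)"
    unfolding past_field_def using subalgebra_field_join(2,3)[OF *(1)[of "{..0}"] *(2)[of "- j"]]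
    by (simp_all add: subalgebra_def)
  ultimately show "T_pow M T (- 1) \<in> past_field Y X j \<rightarrow>\<^sub>M past_field Y X (j + 1)"
    unfolding past_field_def[of _ _ "j + 1"]
    by (intro measurable_field_join *) (blast intro: measurable_from_subalg)+
qed

end

section \<open>Laws of large numbers for shifted martingale increments\<close>

context invertible_ergodic_system
begin

text \<open>Shifting time so that the later increment sits at 0 makes the earlier one a function
  \<open>e'\<close> measurable for H, hence also for F. Against such a factor both conditional
  expectations of h integrate to the mean of \<open>e' * h\<close>, so their difference integrates
  to 0. The functions g and h are unrelated because decisions vary with time.\<close>

lemma past_increments_orthogonal:
  assumes F: "subalgebra M F" and H: "subalgebra M H" and HF: "sets H \<subseteq> sets F"
    and shift: "T_pow M T (- 1) \<in> H \<rightarrow>\<^sub>M F"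
    and [measurable]: "g \<in> borel_measurable M" "h \<in> borel_measurable M"
    and bnd: "\<And>\<omega>. \<omega> \<in> space M \<Longrightarrow> \<bar>g \<omega>\<bar> \<le> C" "\<And>\<omega>. \<omega> \<in> space M \<Longrightarrow> \<bar>h \<omega>\<bar> \<le> C"
    and "i < k"
  shows "(\<integral>\<omega>. (real_cond_exp M F g ((T ^^ i) \<omega>) - real_cond_exp M H g ((T ^^ i) \<omega>)) *
    (real_cond_exp M F h ((T ^^ k) \<omega>) - real_cond_exp M H h ((T ^^ k) \<omega>)) \<partial>M) = 0"
proof -
  interpret F: finite_measure_subalgebra M F by (rule finite_measure_subalgebraI[OF F])
  interpret H: finite_measure_subalgebra M H by (rule finite_measure_subalgebraI[OF H])
  define e where "e \<omega> = real_cond_exp M F g \<omega> - real_cond_exp M H g \<omega>" for \<omega>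
  \<comment> \<open>The lag k - i equals n + 1: one shift takes F into H, and the other n shifts
    stay within H.\<close>
  define n where "n = k - i - 1"
  have FH: "subalgebra F H" using HF H F by (simp add: subalgebra_def)
  \<comment> \<open>Preimages of F-sets under T^{-1} are H-sets, and H lies in F, so T^{-1} is also
    measurable from H to itself and can be iterated.\<close>
  have shift': "T_pow M T (- 1 - int m) \<in> H \<rightarrow>\<^sub>M F" for m
  proof (induction m)
    case (Suc m)
    have "T_pow M T (- 1) \<in> H \<rightarrow>\<^sub>M H"
      by (rule measurableI)
        (use measurable_space[OF shift] measurable_sets[OF shift] FH in \<open>auto simp: subalgebra_def\<close>)
    from measurable_comp[OF this Suc] show ?case
    proof (rule measurable_cong[THEN iffD1, rotated])
      fix \<omega> assume "\<omega> \<in> space H"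
      then have "\<omega> \<in> space M" using H by (simp add: subalgebra_def)
      from T_pow_add[OF this, of "- 1 - int m" "-1"]
      show "(T_pow M T (- 1 - int m) \<circ> T_pow M T (- 1)) \<omega> = T_pow M T (- 1 - int (Suc m)) \<omega>"
        by (simp add: diff_diff_eq add.commute)
    qed
  qed (use shift in simp)
  have int: "integrable M g" "integrable M h"
    by (rule integrable_const_bound[where B = C], use bnd in simp_all)+
  have HsubF: "f \<in> borel_measurable H \<Longrightarrow> f \<in> borel_measurable F" for f :: "'a \<Rightarrow> real"
    by (rule measurable_from_subalg[OF FH])
  have eF: "e \<in> borel_measurable F"
    unfolding e_def by (intro borel_measurable_diff HsubF borel_measurable_cond_exp)
  have ei: "integrable M e" unfolding e_def using int by (auto intro: F.real_cond_exp_int H.real_cond_exp_int)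
  define e' where "e' \<omega> = e (T_pow M T (- 1 - int n) \<omega>)" for \<omega>
  have e'H: "e' \<in> borel_measurable H" unfolding e'_def by (rule measurable_compose[OF shift' eF])
  have e'F: "e' \<in> borel_measurable F" by (rule HsubF[OF e'H])
  have e'i: "integrable M e'" unfolding e'_def by (rule integrable_T_pow[OF ei])
  then have [measurable]: "e' \<in> borel_measurable M" by simp
  have e'h: "integrable M (\<lambda>\<omega>. e' \<omega> * h \<omega>)"
  proof (rule Bochner_Integration.integrable_bound[of M "\<lambda>\<omega>. e' \<omega> * C"])
    show "AE x in M. norm (e' x * h x) \<le> norm (e' x * C)"
      using AE_space by eventually_elim (use bnd(2) in \<open>force simp: abs_mult intro!: mult_left_mono\<close>)
  qed (use e'i in auto)
  have [measurable]: "real_cond_exp M F f \<in> borel_measurable M" "real_cond_exp M H f \<in> borel_measurable M" for f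
    by auto
  have "(\<integral>\<omega>. (real_cond_exp M F g ((T ^^ i) \<omega>) - real_cond_exp M H g ((T ^^ i) \<omega>)) *
    (real_cond_exp M F h ((T ^^ k) \<omega>) - real_cond_exp M H h ((T ^^ k) \<omega>)) \<partial>M)
    = (\<integral>\<omega>. e' ((T ^^ k) \<omega>) * (real_cond_exp M F h ((T ^^ k) \<omega>) - real_cond_exp M H h ((T ^^ k) \<omega>)) \<partial>M)"
  proof (rule Bochner_Integration.integral_cong[OF refl])
    fix \<omega> assume "\<omega> \<in> space M"
    from T_pow_add[OF this, of "- 1 - int n" "int k"] have "T_pow M T (- 1 - int n) ((T ^^ k) \<omega>) = (T ^^ i) \<omega>"
      using \<open>i < k\<close> T_pow_nat[of i] by (simp add: n_def of_nat_diff)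
    then show "(real_cond_exp M F g ((T ^^ i) \<omega>) - real_cond_exp M H g ((T ^^ i) \<omega>)) *
      (real_cond_exp M F h ((T ^^ k) \<omega>) - real_cond_exp M H h ((T ^^ k) \<omega>)) =
      e' ((T ^^ k) \<omega>) * (real_cond_exp M F h ((T ^^ k) \<omega>) - real_cond_exp M H h ((T ^^ k) \<omega>))"
      by (simp add: e'_def e_def)
  qed
  also have "\<dots> = (\<integral>\<omega>. e' \<omega> * (real_cond_exp M F h \<omega> - real_cond_exp M H h \<omega>) \<partial>M)"
    by (rule integral_funpow[of "\<lambda>\<omega>. e' \<omega> * (real_cond_exp M F h \<omega> - real_cond_exp M H h \<omega>)"]) measurable
  also have "\<dots> = (\<integral>\<omega>. e' \<omega> * real_cond_exp M F h \<omega> \<partial>M) - (\<integral>\<omega>. e' \<omega> * real_cond_exp M H h \<omega> \<partial>M)"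
    using F.real_cond_exp_intg(1)[OF e'h e'F] H.real_cond_exp_intg(1)[OF e'h e'H]
    by (simp add: right_diff_distrib)
  also have "\<dots> = 0"
    using F.real_cond_exp_intg(2)[OF e'h e'F] H.real_cond_exp_intg(2)[OF e'h e'H] by simp
  finally show ?thesis .
qed

lemma past_increments_LLN_bounded:
  assumes F: "subalgebra M F" and H: "subalgebra M H" and HF: "sets H \<subseteq> sets F"
    and shift: "T_pow M T (- 1) \<in> H \<rightarrow>\<^sub>M F"
    and h[measurable]: "\<And>k. h k \<in> borel_measurable M"
    and bnd: "\<And>k \<omega>. \<omega> \<in> space M \<Longrightarrow> \<bar>h k \<omega>\<bar> \<le> C"
  shows "AE \<omega> in M. (\<lambda>N. (\<Sum>k=1..N. real_cond_exp M F (h k) ((T ^^ k) \<omega>)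
    - real_cond_exp M H (h k) ((T ^^ k) \<omega>)) / real N) \<longlonglongrightarrow> 0"
proof -
  interpret F: finite_measure_subalgebra M F by (rule finite_measure_subalgebraI[OF F])
  interpret H: finite_measure_subalgebra M H by (rule finite_measure_subalgebraI[OF H])
  have int: "integrable M (h k)" for k
    by (rule integrable_const_bound[where B = C]) (use bnd in simp_all)
  have [measurable]: "real_cond_exp M F f \<in> borel_measurable M" "real_cond_exp M H f \<in> borel_measurable M" for f
    by auto
  define f where "f k \<omega> = real_cond_exp M F (h (Suc k)) ((T ^^ Suc k) \<omega>)
    - real_cond_exp M H (h (Suc k)) ((T ^^ Suc k) \<omega>)" for k \<omega>
  have "AE \<omega> in M. (\<lambda>N. (\<Sum>k<N. f k \<omega>) / real N) \<longlonglongrightarrow> 0"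
  proof (rule bounded_orthogonal_SLLN)
    show "f k \<in> borel_measurable M" for k unfolding f_def by measurable
    fix k
    have "- C \<le> h (Suc k) \<omega> \<and> h (Suc k) \<omega> \<le> C" if "\<omega> \<in> space M" for \<omega>
      using bnd[OF that, of "Suc k"] by linarith
    then have le: "AE \<omega> in M. h (Suc k) \<omega> \<le> C" and ge: "AE \<omega> in M. - C \<le> h (Suc k) \<omega>"
      by simp_all
    have "AE \<omega> in M. \<bar>real_cond_exp M F (h (Suc k)) \<omega> - real_cond_exp M H (h (Suc k)) \<omega>\<bar> \<le> 2 * C"
      using F.real_cond_exp_le_c[OF int le] F.real_cond_exp_ge_c[OF int ge]
        H.real_cond_exp_le_c[OF int le] H.real_cond_exp_ge_c[OF int ge]
      by eventually_elim auto
    then show "AE \<omega> in M. \<bar>f k \<omega>\<bar> \<le> 2 * C" unfolding f_def by (rule AE_funpow)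
    show "(\<integral>\<omega>. f i \<omega> * f k \<omega> \<partial>M) = 0" if "i < k" for i
      unfolding f_def using that bnd by (intro past_increments_orthogonal[OF F H HF shift, where C = C]) auto
  qed
  then show ?thesis by (simp add: f_def sum.atLeast1_atMost_eq)
qed

lemma integrable_tail:
  fixes \<Lambda> :: "'a \<Rightarrow> real"
  assumes \<Lambda>: "integrable M \<Lambda>" and "e > 0"
  shows "\<exists>n::nat. (\<integral>\<omega>. (if \<bar>\<Lambda> \<omega>\<bar> \<le> real n then 0 else \<bar>\<Lambda> \<omega>\<bar>) \<partial>M) < e"
proof -
  have [measurable]: "\<Lambda> \<in> borel_measurable M" using \<Lambda> by simp
  have "(\<lambda>n. \<integral>\<omega>. (if \<bar>\<Lambda> \<omega>\<bar> \<le> real n then 0 else \<bar>\<Lambda> \<omega>\<bar>) \<partial>M) \<longlonglongrightarrow> (\<integral>\<omega>. 0 \<partial>M)"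
  proof (rule integral_dominated_convergence[where w = "\<lambda>\<omega>. \<bar>\<Lambda> \<omega>\<bar>"])
    show "AE \<omega> in M. (\<lambda>n. if \<bar>\<Lambda> \<omega>\<bar> \<le> real n then 0 else \<bar>\<Lambda> \<omega>\<bar>) \<longlonglongrightarrow> 0"
    proof (rule AE_I2, rule tendsto_eventually)
      fix \<omega>
      obtain m :: nat where m: "\<bar>\<Lambda> \<omega>\<bar> \<le> real m" using real_arch_simple by blast
      show "\<forall>\<^sub>F n in sequentially. (if \<bar>\<Lambda> \<omega>\<bar> \<le> real n then 0 else \<bar>\<Lambda> \<omega>\<bar>) = 0"
        using eventually_ge_at_top[of m] by eventually_elim (use m in auto)
    qed
  qed (use \<Lambda> in auto)
  then have "\<forall>\<^sub>F n in sequentially. (\<integral>\<omega>. (if \<bar>\<Lambda> \<omega>\<bar> \<le> real n then 0 else \<bar>\<Lambda> \<omega>\<bar>) \<partial>M) < e"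
    using \<open>e > 0\<close> by (intro order_tendstoD(2)[of _ 0]) auto
  then show ?thesis by (auto simp: eventually_sequentially)
qed

text \<open>The functions \<open>f k\<close> may vary with k as long as d does not: Birkhoff's
  theorem is applied to d alone and controls the averages of f along the same orbit.\<close>

lemma avg_eventually_le:
  assumes d: "integrable M d" and "(\<integral>\<omega>. d \<omega> \<partial>M) < e"
    and f: "\<And>k. AE \<omega> in M. \<bar>f k \<omega>\<bar> \<le> d \<omega>"
  shows "AE \<omega> in M. \<forall>\<^sub>F N in sequentially. \<bar>(\<Sum>k=1..N. f k ((T ^^ k) \<omega>)) / real N\<bar> \<le> e"
proof -
  have "AE \<omega> in M. \<forall>k. \<bar>f k ((T ^^ k) \<omega>)\<bar> \<le> d ((T ^^ k) \<omega>)"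
    unfolding AE_all_countable using AE_funpow[OF f] by blast
  with birkhoff[OF d] show ?thesis
  proof eventually_elim
    case (elim \<omega>)
    from order_tendstoD(2)[OF elim(1) assms(2)] show ?case
    proof eventually_elim
      fix N assume N: "(\<Sum>k=1..N. d ((T ^^ k) \<omega>)) / real N < e"
      have "\<bar>\<Sum>k=1..N. f k ((T ^^ k) \<omega>)\<bar> \<le> (\<Sum>k=1..N. d ((T ^^ k) \<omega>))"
        using elim(2) by (intro order_trans[OF sum_abs] sum_mono) auto
      then have "\<bar>\<Sum>k=1..N. f k ((T ^^ k) \<omega>)\<bar> / real N \<le> (\<Sum>k=1..N. d ((T ^^ k) \<omega>)) / real N"
        by (intro divide_right_mono) auto
      with N show "\<bar>(\<Sum>k=1..N. f k ((T ^^ k) \<omega>)) / real N\<bar> \<le> e" by simp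
    qed
  qed
qed

text \<open>Every \<open>h k\<close> is truncated on the same event {\<bar>\<Lambda>\<bar> \<le> C}.
  The bounded parts obey the previous law, and the increments of the remainders share one envelope q
  of small mean.\<close>

lemma past_increments_LLN:
  assumes F: "subalgebra M F" and H: "subalgebra M H" and HF: "sets H \<subseteq> sets F"
    and shift: "T_pow M T (- 1) \<in> H \<rightarrow>\<^sub>M F"
    and h[measurable]: "\<And>k. h k \<in> borel_measurable M"
    and bnd: "\<And>k \<omega>. \<omega> \<in> space M \<Longrightarrow> \<bar>h k \<omega>\<bar> \<le> \<Lambda> \<omega>" and \<Lambda>: "integrable M \<Lambda>"
  shows "AE \<omega> in M. (\<lambda>N. (\<Sum>k=1..N. real_cond_exp M F (h k) ((T ^^ k) \<omega>)
    - real_cond_exp M H (h k) ((T ^^ k) \<omega>)) / real N) \<longlonglongrightarrow> 0"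
proof (rule AE_tendsto_zeroI)
  interpret F: finite_measure_subalgebra M F by (rule finite_measure_subalgebraI[OF F])
  interpret H: finite_measure_subalgebra M H by (rule finite_measure_subalgebraI[OF H])
  have [measurable]: "\<Lambda> \<in> borel_measurable M" using \<Lambda> by simp
  fix e :: real assume e: "e > 0"
  \<comment> \<open>The tail is conditioned once on F and once on H, so e/4 yields an envelope q of
    mean below e/2.\<close>
  obtain C :: nat where C: "(\<integral>\<omega>. (if \<bar>\<Lambda> \<omega>\<bar> \<le> real C then 0 else \<bar>\<Lambda> \<omega>\<bar>) \<partial>M) < e / 4"
    using integrable_tail[OF \<Lambda>, of "e / 4"] e by auto
  define Q where "Q \<omega> = (if \<bar>\<Lambda> \<omega>\<bar> \<le> real C then 0 else \<bar>\<Lambda> \<omega>\<bar>)" for \<omega>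
  define h1 where "h1 k \<omega> = (if \<bar>\<Lambda> \<omega>\<bar> \<le> real C then h k \<omega> else 0)" for k \<omega>
  define h2 where "h2 k \<omega> = (if \<bar>\<Lambda> \<omega>\<bar> \<le> real C then 0 else h k \<omega>)" for k \<omega>
  have [measurable]: "Q \<in> borel_measurable M" "h1 k \<in> borel_measurable M" "h2 k \<in> borel_measurable M" for k
    unfolding Q_def h1_def h2_def by measurable
  have bnd': "\<bar>h k \<omega>\<bar> \<le> \<bar>\<Lambda> \<omega>\<bar>" if "\<omega> \<in> space M" for k \<omega> using bnd[OF that, of k] by linarith
  have Qi: "integrable M Q" by (rule Bochner_Integration.integrable_bound[OF \<Lambda>]) (auto simp: Q_def)
  have h1i: "integrable M (h1 k)" for k
    by (rule Bochner_Integration.integrable_bound[OF \<Lambda>]) (auto simp: h1_def bnd')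
  have h2i: "integrable M (h2 k)" for k
    by (rule Bochner_Integration.integrable_bound[OF \<Lambda>]) (auto simp: h2_def bnd')
  define q where "q \<omega> = real_cond_exp M F Q \<omega> + real_cond_exp M H Q \<omega>" for \<omega>
  have qi: "integrable M q" unfolding q_def using Qi by (auto intro: F.real_cond_exp_int H.real_cond_exp_int)
  have q: "(\<integral>\<omega>. q \<omega> \<partial>M) < e / 2"
    unfolding q_def using F.real_cond_exp_int[OF Qi] H.real_cond_exp_int[OF Qi] C by (simp add: Q_def)
  have split: "AE \<omega> in M. real_cond_exp M F (h k) \<omega> - real_cond_exp M H (h k) \<omega>
     = (real_cond_exp M F (h1 k) \<omega> - real_cond_exp M H (h1 k) \<omega>)
     + (real_cond_exp M F (h2 k) \<omega> - real_cond_exp M H (h2 k) \<omega>)" for k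
  proof -
    have eq: "h k = (\<lambda>\<omega>. h1 k \<omega> + h2 k \<omega>)" by (auto simp: h1_def h2_def)
    show ?thesis unfolding eq
      using F.real_cond_exp_add[OF h1i h2i, of k k] H.real_cond_exp_add[OF h1i h2i, of k k]
      by eventually_elim simp
  qed
  have h2le: "AE \<omega> in M. \<bar>real_cond_exp M F (h2 k) \<omega> - real_cond_exp M H (h2 k) \<omega>\<bar> \<le> q \<omega>" for k
  proof -
    have "AE \<omega> in M. \<bar>h2 k \<omega>\<bar> \<le> Q \<omega>" by (auto simp: h2_def Q_def bnd')
    from F.real_cond_exp_abs_le[OF h2i Qi this] H.real_cond_exp_abs_le[OF h2i Qi this]
    show ?thesis by eventually_elim (auto simp: q_def)
  qed
  have "AE \<omega> in M. \<forall>k. real_cond_exp M F (h k) ((T ^^ k) \<omega>) - real_cond_exp M H (h k) ((T ^^ k) \<omega>)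
     = (real_cond_exp M F (h1 k) ((T ^^ k) \<omega>) - real_cond_exp M H (h1 k) ((T ^^ k) \<omega>))
     + (real_cond_exp M F (h2 k) ((T ^^ k) \<omega>) - real_cond_exp M H (h2 k) ((T ^^ k) \<omega>))"
    unfolding AE_all_countable using AE_funpow[OF split] by blast
  moreover have "AE \<omega> in M. (\<lambda>N. (\<Sum>k=1..N. real_cond_exp M F (h1 k) ((T ^^ k) \<omega>)
    - real_cond_exp M H (h1 k) ((T ^^ k) \<omega>)) / real N) \<longlonglongrightarrow> 0"
    using bnd' by (intro past_increments_LLN_bounded[OF F H HF shift, where C = "real C"])
      (auto simp: h1_def intro: order_trans)
  moreover have "AE \<omega> in M. \<forall>\<^sub>F N in sequentially. \<bar>(\<Sum>k=1..N. real_cond_exp M F (h2 k) ((T ^^ k) \<omega>)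
    - real_cond_exp M H (h2 k) ((T ^^ k) \<omega>)) / real N\<bar> \<le> e / 2"
    by (rule avg_eventually_le[OF qi q h2le])
  ultimately show "AE \<omega> in M. \<forall>\<^sub>F N in sequentially. \<bar>(\<Sum>k=1..N. real_cond_exp M F (h k) ((T ^^ k) \<omega>)
    - real_cond_exp M H (h k) ((T ^^ k) \<omega>)) / real N\<bar> \<le> e"
  proof eventually_elim
    case (elim \<omega>)
    have "\<forall>\<^sub>F N in sequentially. \<bar>(\<Sum>k=1..N. real_cond_exp M F (h1 k) ((T ^^ k) \<omega>)
      - real_cond_exp M H (h1 k) ((T ^^ k) \<omega>)) / real N\<bar> < e / 2"
      using tendstoD[OF elim(2), of "e / 2"] e by simp
    with elim(3) show ?case
      unfolding elim(1)[rule_format] sum.distrib add_divide_distrib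
      by eventually_elim linarith
  qed
qed

text \<open>The increments of the two-sided martingale are handled by the previous law of large numbers;
  its two ends are controlled uniformly in the decision by hypothesis.\<close>

lemma past_martingale_LLN:
  fixes G :: "int \<Rightarrow> 'a measure"
  assumes G: "\<And>j. subalgebra M (G j)" "\<And>j. sets (G j) \<subseteq> sets (G (j + 1))"
    "\<And>j. T_pow M T (- 1) \<in> G j \<rightarrow>\<^sub>M G (j + 1)"
    and h: "\<And>k. h k \<in> borel_measurable M"
    and bnd: "\<And>k \<omega>. \<omega> \<in> space M \<Longrightarrow> \<bar>h k \<omega>\<bar> \<le> \<Lambda> \<omega>" and \<Lambda>: "integrable M \<Lambda>"
    and top: "\<And>e. e > 0 \<Longrightarrow> \<exists>n d. integrable M d \<and> (\<integral>\<omega>. d \<omega> \<partial>M) < e \<and>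
      (\<forall>k. AE \<omega> in M. \<bar>real_cond_exp M (G (int n)) (h k) \<omega> - h k \<omega>\<bar> \<le> d \<omega>)"
    and bot: "\<And>e. e > 0 \<Longrightarrow> \<exists>n d. integrable M d \<and> (\<integral>\<omega>. d \<omega> \<partial>M) < e \<and>
      (\<forall>k. AE \<omega> in M. \<bar>real_cond_exp M (G (- int n)) (h k) \<omega> - w k \<omega>\<bar> \<le> d \<omega>)"
  shows "AE \<omega> in M. (\<lambda>N. (\<Sum>k=1..N. h k ((T ^^ k) \<omega>) - w k ((T ^^ k) \<omega>)) / real N) \<longlonglongrightarrow> 0"
proof (rule AE_tendsto_zeroI)
  fix e :: real assume e: "e > 0"
  \<comment> \<open>Error budget: e/4 for each end of the martingale and e/2 for all increments
    between them.\<close>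
  obtain n1 d1 where 1: "integrable M d1" "(\<integral>\<omega>. d1 \<omega> \<partial>M) < e / 4"
    "\<And>k. AE \<omega> in M. \<bar>real_cond_exp M (G (int n1)) (h k) \<omega> - h k \<omega>\<bar> \<le> d1 \<omega>"
    using top[of "e / 4"] e by auto
  obtain n2 d2 where 2: "integrable M d2" "(\<integral>\<omega>. d2 \<omega> \<partial>M) < e / 4"
    "\<And>k. AE \<omega> in M. \<bar>real_cond_exp M (G (- int n2)) (h k) \<omega> - w k \<omega>\<bar> \<le> d2 \<omega>"
    using bot[of "e / 4"] e by auto
  define E where "E j k \<omega> = real_cond_exp M (G j) (h k) ((T ^^ k) \<omega>)" for j k \<omega>
  \<comment> \<open>The levels run from -n2 to n1, so i < n1 + n2 enumerates the increments, the
    i-th one starting at level i - n2.\<close>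
  define D where "D i N \<omega> = (\<Sum>k=1..N. E (int i - int n2 + 1) k \<omega> - E (int i - int n2) k \<omega>) / real N" for i N \<omega>
  have "AE \<omega> in M. \<forall>i. (\<lambda>N. D i N \<omega>) \<longlonglongrightarrow> 0"
    unfolding AE_all_countable D_def E_def by (intro allI past_increments_LLN[OF G(1) G(1) G(2) G(3) h bnd \<Lambda>])
  moreover have "AE \<omega> in M. \<forall>\<^sub>F N in sequentially. \<bar>(\<Sum>k=1..N. E (int n1) k \<omega> - h k ((T ^^ k) \<omega>)) / real N\<bar> \<le> e / 4"
    unfolding E_def by (rule avg_eventually_le[OF 1])
  moreover have "AE \<omega> in M. \<forall>\<^sub>F N in sequentially. \<bar>(\<Sum>k=1..N. E (- int n2) k \<omega> - w k ((T ^^ k) \<omega>)) / real N\<bar> \<le> e / 4"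
    unfolding E_def by (rule avg_eventually_le[OF 2])
  ultimately show "AE \<omega> in M. \<forall>\<^sub>F N in sequentially.
      \<bar>(\<Sum>k=1..N. h k ((T ^^ k) \<omega>) - w k ((T ^^ k) \<omega>)) / real N\<bar> \<le> e"
  proof eventually_elim
    case (elim \<omega>)
    have tele: "E (int n1) k \<omega> - E (- int n2) k \<omega> = (\<Sum>i<n1 + n2. E (int i - int n2 + 1) k \<omega> - E (int i - int n2) k \<omega>)" for k
      using sum_lessThan_telescope[of "\<lambda>i. E (int i - int n2) k \<omega>" "n1 + n2"] by (simp add: algebra_simps)
    have "(\<lambda>N. \<Sum>i<n1 + n2. D i N \<omega>) \<longlonglongrightarrow> (\<Sum>i<n1 + n2. 0)"
      using elim(1) by (intro tendsto_sum) auto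
    then have "\<forall>\<^sub>F N in sequentially. \<bar>\<Sum>i<n1 + n2. D i N \<omega>\<bar> < e / 2"
      using tendstoD[of _ 0 _ "e / 2"] e by fastforce
    with elim(2,3) show ?case
    proof eventually_elim
      case (elim N)
      have "(\<Sum>k=1..N. h k ((T ^^ k) \<omega>) - w k ((T ^^ k) \<omega>)) =
        (\<Sum>k=1..N. E (int n1) k \<omega> - E (- int n2) k \<omega>)
        - (\<Sum>k=1..N. E (int n1) k \<omega> - h k ((T ^^ k) \<omega>)) + (\<Sum>k=1..N. E (- int n2) k \<omega> - w k ((T ^^ k) \<omega>))"
        by (simp add: sum_subtractf)
      moreover have "(\<Sum>k=1..N. E (int n1) k \<omega> - E (- int n2) k \<omega>) / real N = (\<Sum>i<n1 + n2. D i N \<omega>)"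
        unfolding tele D_def by (subst sum.swap) (simp add: sum_divide_distrib)
      ultimately have "(\<Sum>k=1..N. h k ((T ^^ k) \<omega>) - w k ((T ^^ k) \<omega>)) / real N = (\<Sum>i<n1 + n2. D i N \<omega>)
        - (\<Sum>k=1..N. E (int n1) k \<omega> - h k ((T ^^ k) \<omega>)) / real N
        + (\<Sum>k=1..N. E (- int n2) k \<omega> - w k ((T ^^ k) \<omega>)) / real N"
        by (simp only: add_divide_distrib diff_divide_distrib)
      then show ?case using elim by linarith
    qed
  qed
qed

end

section \<open>The decision problem\<close>

locale decision_problem = invertible_ergodic_system +
  fixes Y :: "'a measure" and U :: "'u measure" and l :: "'u \<Rightarrow> 'a \<Rightarrow> real" and \<Lambda> :: "'a \<Rightarrow> real"
  assumes Y: "subalgebra M Y"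
    and l: "(\<lambda>(u, \<omega>). l u \<omega>) \<in> borel_measurable (U \<Otimes>\<^sub>M M)"
    and \<Lambda>: "integrable M \<Lambda>"
    and l_le: "\<And>u \<omega>. u \<in> space U \<Longrightarrow> \<omega> \<in> space M \<Longrightarrow> \<bar>l u \<omega>\<bar> \<le> \<Lambda> \<omega>"
    and U_nonempty: "space U \<noteq> {}"
begin

lemma \<Lambda>_measurable[measurable]: "\<Lambda> \<in> borel_measurable M"
  using \<Lambda> by simp

lemma \<Lambda>_nonneg: "\<omega> \<in> space M \<Longrightarrow> 0 \<le> \<Lambda> \<omega>"
  using l_le U_nonempty by (meson abs_ge_zero all_not_in_conv order_trans)

lemma loss_at_0: "loss_at M T l 0 u = (\<lambda>\<omega>. l (u \<omega>) \<omega>)"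
  by (simp add: loss_at_def)

lemma decisions_between_mono:
  "m' \<le> m \<Longrightarrow> n \<le> n' \<Longrightarrow> decisions_between M T Y U m n \<subseteq> decisions_between M T Y U m' n'"
  unfolding decisions_between_def
  using sets_obs_field_mono[OF Y, of "{m..n}" "{m'..n'}"]
  by (auto intro!: measurable_from_subalg[of "obs_field M T Y {m'..n'}" "obs_field M T Y {m..n}"] simp: subalgebra_def)

lemma decisions_measurable: "u \<in> decisions M T Y U n \<Longrightarrow> u \<in> M \<rightarrow>\<^sub>M U"
  unfolding decisions_def decisions_between_def
  by (auto intro: measurable_from_subalg[OF subalgebra_obs_field[OF Y]])

lemma const_decision: "x \<in> space U \<Longrightarrow> (\<lambda>_. x) \<in> decisions_between M T Y U m n"
  by (simp add: decisions_between_def)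

lemma decisions_nonempty: "decisions M T Y U 0 \<noteq> {}"
  using U_nonempty const_decision[of _ 0 0] by (auto simp: decisions_def)

lemma decisions_0_cases:
  assumes "u \<in> decisions M T Y U 0"
  obtains m :: nat where "u \<in> decisions_between M T Y U (- int m) 0"
proof -
  obtain m where m: "m \<le> 0" "u \<in> decisions_between M T Y U m 0"
    using assms by (auto simp: decisions_def)
  then show ?thesis using that[of "nat (- m)"] by simp
qed

lemma decisions_0I: "u \<in> decisions_between M T Y U (- int m) 0 \<Longrightarrow> u \<in> decisions M T Y U 0"
  by (auto simp: decisions_def intro!: bexI[of _ "- int m"])

lemma shift_decision:
  assumes "u \<in> decisions_between M T Y U m n" and "a = m + j" "b = n + j"
  shows "(\<lambda>\<omega>. u (T_pow M T j \<omega>)) \<in> decisions_between M T Y U a b"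
  using assms unfolding decisions_between_def
  by (intro measurable_compose[OF T_pow_measurable_obs_field[OF Y]]) auto

lemma loss_measurable:
  assumes "u \<in> decisions M T Y U 0"
  shows "loss_at M T l 0 u \<in> borel_measurable M"
proof -
  have "(\<lambda>\<omega>. (u \<omega>, \<omega>)) \<in> M \<rightarrow>\<^sub>M U \<Otimes>\<^sub>M M" using decisions_measurable[OF assms] by measurable
  from measurable_compose[OF this l] show ?thesis by (simp add: loss_at_0)
qed

lemma loss_le:
  assumes "u \<in> decisions M T Y U 0" "\<omega> \<in> space M"
  shows "\<bar>loss_at M T l 0 u \<omega>\<bar> \<le> \<Lambda> \<omega>"
  using l_le measurable_space[OF decisions_measurable[OF assms(1)]] assms(2) by (simp add: loss_at_0)

lemma loss_integrable:
  assumes "u \<in> decisions M T Y U 0"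
  shows "integrable M (loss_at M T l 0 u)"
  using loss_le[OF assms] loss_measurable[OF assms]
  by (intro Bochner_Integration.integrable_bound[OF \<Lambda>]) (auto intro!: AE_I2 order_trans[OF _ abs_ge_self])

lemma cond_loss_le:
  assumes F: "subalgebra M F" and u: "u \<in> decisions M T Y U 0"
  shows "AE \<omega> in M. \<bar>real_cond_exp M F (loss_at M T l 0 u) \<omega>\<bar> \<le> real_cond_exp M F \<Lambda> \<omega>"
proof -
  interpret F: finite_measure_subalgebra M F by (rule finite_measure_subalgebraI[OF F])
  show ?thesis using loss_le[OF u] by (intro F.real_cond_exp_abs_le loss_integrable u \<Lambda>) auto
qed

definition optimal_cond_loss :: "'a measure \<Rightarrow> 'a \<Rightarrow> real" where
  "optimal_cond_loss F \<omega> = real_of_ereal (family_essinf M (decisions M T Y U 0)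
     (\<lambda>u \<omega>. ereal (real_cond_exp M F (loss_at M T l 0 u) \<omega>)) \<omega>)"

lemma integral_optimal_cond_loss:
  "(\<integral>\<omega>. optimal_cond_loss F \<omega> \<partial>M) = mean_optimal_loss M T Y U l F"
  by (simp add: optimal_cond_loss_def mean_optimal_loss_def)

text \<open>The essential infimum lies above -E[\<Lambda> | F], a lower bound of all members, and
  below a single member, itself at most E[\<Lambda> | F]. Hence it is finite almost surely and
  integrable, and its real version is again an essential infimum.\<close>

lemma optimal_cond_loss:
  assumes F: "subalgebra M F"
  shows "is_family_essinf M (decisions M T Y U 0)
      (\<lambda>u \<omega>. ereal (real_cond_exp M F (loss_at M T l 0 u) \<omega>)) (\<lambda>\<omega>. ereal (optimal_cond_loss F \<omega>))"
    and "integrable M (optimal_cond_loss F)"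
proof -
  interpret F: finite_measure_subalgebra M F by (rule finite_measure_subalgebraI[OF F])
  let ?f = "\<lambda>u \<omega>. ereal (real_cond_exp M F (loss_at M T l 0 u) \<omega>)"
  define V where "V = family_essinf M (decisions M T Y U 0) ?f"
  have V: "is_family_essinf M (decisions M T Y U 0) ?f V"
    unfolding V_def by (intro family_essinf) auto
  have [measurable]: "V \<in> borel_measurable M" using V by (simp add: is_family_essinf_def)
  have \<Lambda>m[measurable]: "real_cond_exp M F \<Lambda> \<in> borel_measurable M" by auto
  obtain u where u: "u \<in> decisions M T Y U 0" using decisions_nonempty by blast
  have "AE \<omega> in M. ereal (- real_cond_exp M F \<Lambda> \<omega>) \<le> V \<omega>"
  proof -
    have "AE \<omega> in M. ereal (- real_cond_exp M F \<Lambda> \<omega>) \<le> ?f u \<omega>" if "u \<in> decisions M T Y U 0" for u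
      using cond_loss_le[OF F that] by eventually_elim auto
    moreover have "(\<lambda>\<omega>. ereal (- real_cond_exp M F \<Lambda> \<omega>)) \<in> borel_measurable M" by measurable
    ultimately show ?thesis by (intro is_family_essinf_greatest[OF V])
  qed
  moreover have "AE \<omega> in M. V \<omega> \<le> ?f u \<omega>" by (rule is_family_essinf_lower[OF V u])
  ultimately have V': "AE \<omega> in M. ereal (optimal_cond_loss F \<omega>) = V \<omega> \<and>
      \<bar>optimal_cond_loss F \<omega>\<bar> \<le> real_cond_exp M F \<Lambda> \<omega>"
    using cond_loss_le[OF F u]
  proof eventually_elim
    case (elim \<omega>)
    then show ?case
      by (cases "V \<omega>") (auto simp: optimal_cond_loss_def V_def[symmetric])
  qed
  have om: "optimal_cond_loss F \<in> borel_measurable M"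
    unfolding optimal_cond_loss_def[abs_def] V_def[symmetric] by measurable
  show "integrable M (optimal_cond_loss F)"
  proof (rule Bochner_Integration.integrable_bound[OF F.real_cond_exp_int(1)[OF \<Lambda>] om])
    show "AE \<omega> in M. norm (optimal_cond_loss F \<omega>) \<le> norm (real_cond_exp M F \<Lambda> \<omega>)"
      using V' by eventually_elim auto
  qed
  show "is_family_essinf M (decisions M T Y U 0) ?f (\<lambda>\<omega>. ereal (optimal_cond_loss F \<omega>))"
    unfolding is_family_essinf_def
  proof (intro conjI ballI impI)
    show "(\<lambda>\<omega>. ereal (optimal_cond_loss F \<omega>)) \<in> borel_measurable M" using om by measurable
    fix u assume "u \<in> decisions M T Y U 0"
    then have "AE \<omega> in M. V \<omega> \<le> ?f u \<omega>" by (rule is_family_essinf_lower[OF V])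
    then show "AE \<omega> in M. ereal (optimal_cond_loss F \<omega>) \<le> ?f u \<omega>"
      using V' by eventually_elim simp
  next
    fix h :: "'a \<Rightarrow> ereal" assume "h \<in> borel_measurable M" "\<forall>u\<in>decisions M T Y U 0. AE \<omega> in M. h \<omega> \<le> ?f u \<omega>"
    then have "AE \<omega> in M. h \<omega> \<le> V \<omega>" by (intro is_family_essinf_greatest[OF V]) auto
    then show "AE \<omega> in M. h \<omega> \<le> ereal (optimal_cond_loss F \<omega>)"
      using V' by eventually_elim simp
  qed
qed

lemma optimal_cond_loss_le:
  assumes F: "subalgebra M F" and u: "u \<in> decisions M T Y U 0"
  shows "AE \<omega> in M. optimal_cond_loss F \<omega> \<le> real_cond_exp M F (loss_at M T l 0 u) \<omega>"
  using is_family_essinf_lower[OF optimal_cond_loss(1)[OF F] u] by simp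

end

section \<open>Near-optimal decisions with finite memory\<close>

context decision_problem
begin

text \<open>The finite-window fields increase with the window, so their union is an algebra; it
  generates the field of the whole past. The approximation is made for the measure with density
  \<open>\<Lambda>\<close>, since a wrong decision on an event costs up to a multiple of
  \<open>\<Lambda>\<close> there.\<close>

lemma approx_by_recent_observations:
  assumes A: "A \<in> sets (obs_field M T Y {..0})" and e: "e > 0"
  obtains m :: int and B where "m \<le> 0" "B \<in> sets (obs_field M T Y {m..0})"
    "(\<integral>\<omega>. \<Lambda> \<omega> * indicator (A - B \<union> (B - A)) \<omega> \<partial>M) < e"
proof -
  define N where "N = density M (\<lambda>\<omega>. ennreal (\<Lambda> \<omega>))"
  define \<A> where "\<A> = (\<Union>m\<in>{..0::int}. sets (obs_field M T Y {m..0}))"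
  have sN[simp]: "space N = space M" "sets N = sets M" by (simp_all add: N_def)
  have subM: "sets (obs_field M T Y K) \<subseteq> sets M" for K
    using subalgebra_obs_field[OF Y] by (simp add: subalgebra_def)
  have sub: "\<A> \<subseteq> sets M" unfolding \<A>_def using subM by blast
  have mN: "emeasure N S = ennreal (\<integral>\<omega>. \<Lambda> \<omega> * indicator S \<omega> \<partial>M)" if [measurable]: "S \<in> sets M" for S
  proof -
    have i: "integrable M (\<lambda>\<omega>. \<Lambda> \<omega> * indicator S \<omega>)"
      using integrable_mult_indicator[OF that \<Lambda>] by (simp add: mult.commute)
    have "emeasure N S = (\<integral>\<^sup>+\<omega>. ennreal (\<Lambda> \<omega>) * indicator S \<omega> \<partial>M)"
      unfolding N_def by (intro emeasure_density) auto
    also have "\<dots> = (\<integral>\<^sup>+\<omega>. ennreal (\<Lambda> \<omega> * indicator S \<omega>) \<partial>M)"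
      by (intro nn_integral_cong) (auto split: split_indicator)
    also have "\<dots> = ennreal (\<integral>\<omega>. \<Lambda> \<omega> * indicator S \<omega> \<partial>M)"
      using \<Lambda>_nonneg by (intro nn_integral_eq_integral[OF i]) (auto intro!: AE_I2 split: split_indicator)
    finally show ?thesis .
  qed
  interpret N: finite_measure N
    using mN[of "space M"] by (intro finite_measureI) simp
  have alg: "algebra (space N) \<A>"
    unfolding algebra_iff_Un
  proof (intro conjI ballI)
    show "\<A> \<subseteq> Pow (space N)" using sub sets.space_closed[of M] by auto
    show "{} \<in> \<A>" unfolding \<A>_def by auto
    show "space N - a \<in> \<A>" if a: "a \<in> \<A>" for a
    proof -
      obtain m where "m \<le> 0" "a \<in> sets (obs_field M T Y {m..0})" using a by (auto simp: \<A>_def)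
      then have "space (obs_field M T Y {m..0}) - a \<in> sets (obs_field M T Y {m..0})"
        by (intro sets.compl_sets)
      with \<open>m \<le> 0\<close> show ?thesis by (auto simp: \<A>_def)
    qed
    show "a \<union> b \<in> \<A>" if ab: "a \<in> \<A>" "b \<in> \<A>" for a b
    proof -
      obtain m m' where m: "m \<le> 0" "a \<in> sets (obs_field M T Y {m..0})"
          "m' \<le> 0" "b \<in> sets (obs_field M T Y {m'..0})"
        using ab by (auto simp: \<A>_def)
      have "a \<in> sets (obs_field M T Y {min m m'..0})" "b \<in> sets (obs_field M T Y {min m m'..0})"
        using m sets_obs_field_mono[OF Y, of "{m..0}" "{min m m'..0}"]
          sets_obs_field_mono[OF Y, of "{m'..0}" "{min m m'..0}"] by auto
      then have "a \<union> b \<in> sets (obs_field M T Y {min m m'..0})" by (rule sets.Un)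
      with m(1) show ?thesis unfolding \<A>_def by (intro UN_I[of "min m m'"]) auto
    qed
  qed
  have "sets (obs_field M T Y {..0}) \<subseteq> sigma_sets (space N) \<A>"
    unfolding obs_field_def[of _ _ _ "{..0}"] sets_measure_of[OF obs_field_generators[OF Y]] sN
  proof (rule sigma_sets_mono', rule UN_least)
    fix k :: int assume k: "k \<in> {..0}"
    then have "sets (T_image M T (- k) Y) \<subseteq> sets (obs_field M T Y {k..0})"
      by (intro sets_T_image_obs_field[OF Y]) auto
    then show "sets (T_image M T (- k) Y) \<subseteq> \<A>" using k by (auto simp: \<A>_def)
  qed
  with A have "A \<in> sigma_sets (space N) \<A>" by blast
  from N.sigma_sets_approx[OF this alg _ e] sub obtain B
    where B: "B \<in> \<A>" "measure N (A - B \<union> (B - A)) < e" by auto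
  have "A \<in> sets M" "B \<in> sets M" using A subM B sub by auto
  then have D: "A - B \<union> (B - A) \<in> sets M" by auto
  have "0 \<le> (\<integral>\<omega>. \<Lambda> \<omega> * indicator (A - B \<union> (B - A)) \<omega> \<partial>M)"
    using \<Lambda>_nonneg by (intro integral_nonneg_AE) (auto intro!: AE_I2)
  then have "measure N (A - B \<union> (B - A)) = (\<integral>\<omega>. \<Lambda> \<omega> * indicator (A - B \<union> (B - A)) \<omega> \<partial>M)"
    using mN[OF D] by (simp add: measure_def)
  with B that show ?thesis by (auto simp: \<A>_def)
qed

abbreviation past_cond_loss :: "('a \<Rightarrow> 'u) \<Rightarrow> 'a \<Rightarrow> real" where
  "past_cond_loss u \<equiv> real_cond_exp M (obs_field M T Y {..0}) (loss_at M T l 0 u)"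

text \<open>Using u on A = {E[u-loss | past] <= E[v-loss | past]} and v elsewhere would realize the
  minimum exactly, but A may need infinite memory. A is replaced by a finite-window event B; the
  loss changes only on the symmetric difference, by at most 2 \<Lambda>, which explains the
  tolerance e/2 for B.\<close>

lemma glue_decisions:
  assumes u: "u \<in> decisions M T Y U 0" and v: "v \<in> decisions M T Y U 0" and e: "e > 0"
  obtains w where "w \<in> decisions M T Y U 0"
    "(\<integral>\<omega>. \<bar>past_cond_loss w \<omega> - min (past_cond_loss u \<omega>) (past_cond_loss v \<omega>)\<bar> \<partial>M) < e"
proof -
  let ?F = "obs_field M T Y {..0}"
  have sub: "subalgebra M ?F" by (rule subalgebra_obs_field[OF Y])
  interpret F: finite_measure_subalgebra M ?F by (rule finite_measure_subalgebraI[OF sub])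
  define A where "A = {\<omega>\<in>space ?F. past_cond_loss u \<omega> \<le> past_cond_loss v \<omega>}"
  have AF[measurable]: "A \<in> sets ?F" unfolding A_def by measurable
  then have AM[measurable]: "A \<in> sets M" using sub by (auto simp: subalgebra_def)
  obtain m B where m: "m \<le> 0" and B: "B \<in> sets (obs_field M T Y {m..0})"
    and AB: "(\<integral>\<omega>. \<Lambda> \<omega> * indicator (A - B \<union> (B - A)) \<omega> \<partial>M) < e / 2"
    using approx_by_recent_observations[OF AF, of "e / 2"] e by auto
  have BM[measurable]: "B \<in> sets M"
    using B subalgebra_obs_field[OF Y] by (auto simp: subalgebra_def)
  obtain mu mv where mu: "mu \<le> 0" "u \<in> decisions_between M T Y U mu 0"
    and mv: "mv \<le> 0" "v \<in> decisions_between M T Y U mv 0"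
    using u v by (auto simp: decisions_def)
  define m' where "m' = min m (min mu mv)"
  define w where "w \<omega> = (if \<omega> \<in> B then u \<omega> else v \<omega>)" for \<omega>
  have "B \<in> sets (obs_field M T Y {m'..0})"
    using B sets_obs_field_mono[OF Y, of "{m..0}" "{m'..0}"] by (auto simp: m'_def)
  moreover have "u \<in> decisions_between M T Y U m' 0" "v \<in> decisions_between M T Y U m' 0"
    using mu(2) mv(2) decisions_between_mono[of m' mu 0 0] decisions_between_mono[of m' mv 0 0]
    unfolding m'_def by (auto simp: subset_iff)
  ultimately have "w \<in> decisions_between M T Y U m' 0"
    unfolding decisions_between_def w_def by (intro measurable_If_set) (auto intro!: sets.Int)
  then have w: "w \<in> decisions M T Y U 0"
    unfolding decisions_def using m by (intro UN_I[of m']) (auto simp: m'_def)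
  let ?L = "loss_at M T l 0"
  define D where "D = A - B \<union> (B - A)"
  have [measurable]: "D \<in> sets M" unfolding D_def by measurable
  have Li: "integrable M (?L u)" "integrable M (?L v)" "integrable M (?L w)"
    using loss_integrable u v w by auto
  note [measurable] = loss_measurable[OF u] loss_measurable[OF v] loss_measurable[OF w]
  have ii: "integrable M (\<lambda>\<omega>. indicator S \<omega> * f \<omega>)" if "S \<in> sets M" "integrable M f" for S and f :: "'a \<Rightarrow> real"
    using integrable_mult_indicator[OF that] by simp
  \<comment> \<open>The loss of the ideal glued decision. Because A belongs to the past field, its
    indicators leave the conditional expectation and the minimum appears.\<close>
  define y where "y \<omega> = indicator A \<omega> * ?L u \<omega> + indicator (space M - A) \<omega> * ?L v \<omega>" for \<omega>
  have yi: "integrable M y" unfolding y_def by (intro Bochner_Integration.integrable_add ii Li) auto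
  have "AE \<omega> in M. real_cond_exp M ?F y \<omega> = real_cond_exp M ?F (\<lambda>\<omega>. indicator A \<omega> * ?L u \<omega>) \<omega>
      + real_cond_exp M ?F (\<lambda>\<omega>. indicator (space M - A) \<omega> * ?L v \<omega>) \<omega>"
    unfolding y_def[abs_def] by (intro F.real_cond_exp_add ii Li) auto
  moreover have "AE \<omega> in M. real_cond_exp M ?F (\<lambda>\<omega>. indicator A \<omega> * ?L u \<omega>) \<omega> = indicator A \<omega> * past_cond_loss u \<omega>"
    by (intro F.real_cond_exp_mult ii Li) auto
  moreover have "space M - A \<in> sets ?F" using sets.compl_sets[OF AF] by simp
  then have "AE \<omega> in M. real_cond_exp M ?F (\<lambda>\<omega>. indicator (space M - A) \<omega> * ?L v \<omega>) \<omega>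
      = indicator (space M - A) \<omega> * past_cond_loss v \<omega>"
    by (intro F.real_cond_exp_mult ii Li) auto
  moreover have "AE \<omega> in M. real_cond_exp M ?F (\<lambda>\<omega>. ?L w \<omega> - y \<omega>) \<omega> = past_cond_loss w \<omega> - real_cond_exp M ?F y \<omega>"
    by (intro F.real_cond_exp_diff Li yi)
  moreover have Di: "integrable M (\<lambda>\<omega>. 2 * (\<Lambda> \<omega> * indicator D \<omega>))"
    using ii[of D \<Lambda>] \<Lambda> by (simp add: mult.commute)
  have "\<bar>?L w \<omega> - y \<omega>\<bar> \<le> 2 * (\<Lambda> \<omega> * indicator D \<omega>)" if "\<omega> \<in> space M" for \<omega>
    using loss_le[OF u that] loss_le[OF v that] that
    by (auto simp: y_def w_def D_def loss_at_0 split: split_indicator)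
  then have "AE \<omega> in M. \<bar>real_cond_exp M ?F (\<lambda>\<omega>. ?L w \<omega> - y \<omega>) \<omega>\<bar>
      \<le> real_cond_exp M ?F (\<lambda>\<omega>. 2 * (\<Lambda> \<omega> * indicator D \<omega>)) \<omega>"
    using Li yi by (intro F.real_cond_exp_abs_le Di) auto
  ultimately have le: "AE \<omega> in M. \<bar>past_cond_loss w \<omega> - min (past_cond_loss u \<omega>) (past_cond_loss v \<omega>)\<bar>
      \<le> real_cond_exp M ?F (\<lambda>\<omega>. 2 * (\<Lambda> \<omega> * indicator D \<omega>)) \<omega>"
    using AE_space
  proof eventually_elim
    case (elim \<omega>)
    have "indicator A \<omega> * past_cond_loss u \<omega> + indicator (space M - A) \<omega> * past_cond_loss v \<omega>
        = min (past_cond_loss u \<omega>) (past_cond_loss v \<omega>)"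
      using elim(6) by (auto simp: A_def split: split_indicator)
    with elim show ?case by simp
  qed
  have "(\<integral>\<omega>. \<bar>past_cond_loss w \<omega> - min (past_cond_loss u \<omega>) (past_cond_loss v \<omega>)\<bar> \<partial>M)
      \<le> (\<integral>\<omega>. real_cond_exp M ?F (\<lambda>\<omega>. 2 * (\<Lambda> \<omega> * indicator D \<omega>)) \<omega> \<partial>M)"
  proof (rule integral_mono_AE[OF _ _ le])
    show "integrable M (\<lambda>\<omega>. \<bar>past_cond_loss w \<omega> - min (past_cond_loss u \<omega>) (past_cond_loss v \<omega>)\<bar>)"
      using F.real_cond_exp_int(1) Li by (intro integrable_abs Bochner_Integration.integrable_diff integrable_min) auto
  qed (rule F.real_cond_exp_int(1)[OF Di])
  also have "\<dots> = 2 * (\<integral>\<omega>. \<Lambda> \<omega> * indicator D \<omega> \<partial>M)"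
    using F.real_cond_exp_int(2)[OF Di] by simp
  also have "\<dots> < e" using AB by (simp add: D_def)
  finally show ?thesis using that w by blast
qed

text \<open>Each induction step glues one more decision. Since min is 1-Lipschitz, the error of the
  decision already built passes on without growth; it and the new gluing error get e/2 each.\<close>

lemma finite_near_optimal_decision:
  fixes u :: "nat \<Rightarrow> 'a \<Rightarrow> 'u"
  assumes u: "\<And>i. u i \<in> decisions M T Y U 0" and e: "e > 0"
  shows "\<exists>w\<in>decisions M T Y U 0.
    (\<integral>\<omega>. \<bar>past_cond_loss w \<omega> - (MIN i\<in>{..n}. past_cond_loss (u i) \<omega>)\<bar> \<partial>M) < e"
  using e
proof (induction n arbitrary: e)
  case 0
  then show ?case by (intro bexI[OF _ u[of 0]]) simp
next
  case (Suc n)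
  have sub: "subalgebra M (obs_field M T Y {..0})" by (rule subalgebra_obs_field[OF Y])
  interpret F: finite_measure_subalgebra M "obs_field M T Y {..0}" by (rule finite_measure_subalgebraI[OF sub])
  have ci: "integrable M (past_cond_loss v)" if "v \<in> decisions M T Y U 0" for v
    by (rule F.real_cond_exp_int(1)[OF loss_integrable[OF that]])
  define p where "p n \<omega> = (MIN i\<in>{..n}. past_cond_loss (u i) \<omega>)" for n \<omega>
  have pS: "p (Suc n) = (\<lambda>\<omega>. min (p n \<omega>) (past_cond_loss (u (Suc n)) \<omega>))" for n
    by (simp add: p_def atMost_Suc fun_eq_iff min.commute)
  have pi: "integrable M (p n)" for n
  proof (induction n)
    case 0 show ?case using ci[OF u] by (simp add: p_def)
  next
    case (Suc n) then show ?case unfolding pS by (intro integrable_min ci u)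
  qed
  obtain v where v: "v \<in> decisions M T Y U 0" "(\<integral>\<omega>. \<bar>past_cond_loss v \<omega> - p n \<omega>\<bar> \<partial>M) < e / 2"
    using Suc.IH[of "e / 2"] Suc.prems by (auto simp: p_def)
  obtain w where w: "w \<in> decisions M T Y U 0"
    "(\<integral>\<omega>. \<bar>past_cond_loss w \<omega> - min (past_cond_loss v \<omega>) (past_cond_loss (u (Suc n)) \<omega>)\<bar> \<partial>M) < e / 2"
    using glue_decisions[OF v(1) u[of "Suc n"], of "e / 2"] Suc.prems by auto
  have "(\<integral>\<omega>. \<bar>past_cond_loss w \<omega> - p (Suc n) \<omega>\<bar> \<partial>M)
      \<le> (\<integral>\<omega>. \<bar>past_cond_loss w \<omega> - min (past_cond_loss v \<omega>) (past_cond_loss (u (Suc n)) \<omega>)\<bar>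
          + \<bar>past_cond_loss v \<omega> - p n \<omega>\<bar> \<partial>M)"
  proof (rule integral_mono)
    show "\<bar>past_cond_loss w \<omega> - p (Suc n) \<omega>\<bar>
      \<le> \<bar>past_cond_loss w \<omega> - min (past_cond_loss v \<omega>) (past_cond_loss (u (Suc n)) \<omega>)\<bar>
          + \<bar>past_cond_loss v \<omega> - p n \<omega>\<bar>" for \<omega>
      unfolding pS by (auto simp: min_def)
  qed (intro integrable_abs Bochner_Integration.integrable_diff Bochner_Integration.integrable_add integrable_min ci pi u v(1) w(1))+
  also have "\<dots> = (\<integral>\<omega>. \<bar>past_cond_loss w \<omega> - min (past_cond_loss v \<omega>) (past_cond_loss (u (Suc n)) \<omega>)\<bar> \<partial>M)
          + (\<integral>\<omega>. \<bar>past_cond_loss v \<omega> - p n \<omega>\<bar> \<partial>M)"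
    by (intro Bochner_Integration.integral_add integrable_abs Bochner_Integration.integrable_diff integrable_min ci pi u v(1) w(1))
  also have "\<dots> < e" using v(2) w(2) by simp
  finally show ?case using w(1) by (auto simp: p_def)
qed

text \<open>The essential infimum is a countable infimum, hence the decreasing limit of finite
  minima \<open>p n\<close>, whose means converge by domination. A finite minimum is nearly realized
  by one decision, and the mean of its conditional loss is its mean loss.\<close>

lemma near_optimal_decision:
  assumes e: "e > 0"
  shows "\<exists>w\<in>decisions M T Y U 0. (\<integral>\<omega>. loss_at M T l 0 w \<omega> \<partial>M) < L_star M T Y U l + e"
proof -
  let ?F = "obs_field M T Y {..0}" and ?D = "decisions M T Y U 0"
  have sub: "subalgebra M ?F" by (rule subalgebra_obs_field[OF Y])
  interpret F: finite_measure_subalgebra M ?F by (rule finite_measure_subalgebraI[OF sub])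
  have ci: "integrable M (past_cond_loss v)" if "v \<in> ?D" for v
    by (rule F.real_cond_exp_int(1)[OF loss_integrable[OF that]])
  define v where "v = optimal_cond_loss ?F"
  note v = optimal_cond_loss[OF sub, folded v_def]
  obtain J where J: "countable J" "J \<subseteq> ?D"
    and Jinf: "is_family_essinf M ?D (\<lambda>u \<omega>. ereal (past_cond_loss u \<omega>)) (\<lambda>\<omega>. INF u\<in>J. ereal (past_cond_loss u \<omega>))"
    using family_essinf_countable[of ?D "\<lambda>u \<omega>. ereal (past_cond_loss u \<omega>)"] by auto
  have vJ: "AE \<omega> in M. ereal (v \<omega>) = (INF u\<in>J. ereal (past_cond_loss u \<omega>))"
    by (rule is_family_essinf_AE_unique[OF v(1) Jinf])
  \<comment> \<open>An empty infimum would be plus infinity, whereas the essential infimum has the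
    real version v.\<close>
  have "J \<noteq> {}"
  proof
    assume "J = {}"
    then have "AE \<omega> in M. False" using vJ by (simp add: top_ereal_def)
    then show False by simp
  qed
  define u where "u = from_nat_into J"
  have uJ: "range u = J" unfolding u_def using J(1) \<open>J \<noteq> {}\<close> by (rule range_from_nat_into[rotated])
  have u: "u i \<in> ?D" for i using uJ J(2) by auto
  define p where "p n \<omega> = (MIN i\<in>{..n}. past_cond_loss (u i) \<omega>)" for n \<omega>
  have pm: "p n \<in> borel_measurable M" for n unfolding p_def by (intro borel_measurable_Min) auto
  have p_le: "p n \<omega> \<le> past_cond_loss (u i) \<omega>" if "i \<le> n" for n i \<omega>
    unfolding p_def using that by (intro Min_le) auto
  have p_ex: "\<exists>i. p n \<omega> = past_cond_loss (u i) \<omega>" for n \<omega>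
  proof -
    have "p n \<omega> \<in> (\<lambda>i. past_cond_loss (u i) \<omega>) ` {..n}" unfolding p_def by (rule Min_in) auto
    then show ?thesis by blast
  qed
  have p_dec: "p (Suc n) \<omega> \<le> p n \<omega>" for n \<omega>
    unfolding p_def by (intro Min_antimono) auto
  have v_le: "AE \<omega> in M. \<forall>i. v \<omega> \<le> past_cond_loss (u i) \<omega>"
    unfolding AE_all_countable v_def using optimal_cond_loss_le[OF sub u] by blast
  have bnd: "AE \<omega> in M. \<forall>i. \<bar>past_cond_loss (u i) \<omega>\<bar> \<le> real_cond_exp M ?F \<Lambda> \<omega>"
    unfolding AE_all_countable using cond_loss_le[OF sub u] by blast
  have lim: "(\<lambda>n. \<integral>\<omega>. p n \<omega> \<partial>M) \<longlonglongrightarrow> (\<integral>\<omega>. v \<omega> \<partial>M)"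
  proof (rule integral_dominated_convergence[where w = "real_cond_exp M ?F \<Lambda>"])
    show "v \<in> borel_measurable M" using v(2) by simp
    show "p n \<in> borel_measurable M" for n by (rule pm)
    show "integrable M (real_cond_exp M ?F \<Lambda>)" by (rule F.real_cond_exp_int(1)[OF \<Lambda>])
    show "AE \<omega> in M. norm (p n \<omega>) \<le> real_cond_exp M ?F \<Lambda> \<omega>" for n
      using bnd by eventually_elim (metis p_ex real_norm_def)
    show "AE \<omega> in M. (\<lambda>n. p n \<omega>) \<longlonglongrightarrow> v \<omega>"
      using vJ v_le
    proof eventually_elim
      case (elim \<omega>)
      have vp: "v \<omega> \<le> p n \<omega>" for n using p_ex[of n \<omega>] elim(2) by auto
      have "decseq (\<lambda>n. p n \<omega>)" by (intro decseq_SucI p_dec)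
      then obtain z where z: "(\<lambda>n. p n \<omega>) \<longlonglongrightarrow> z" "\<And>n. z \<le> p n \<omega>"
        using decseq_convergent[of "\<lambda>n. p n \<omega>" "v \<omega>"] vp by auto
      have "z \<le> past_cond_loss (u i) \<omega>" for i using z(2)[of i] p_le[of i i \<omega>] by simp
      then have "ereal z \<le> (INF u\<in>J. ereal (past_cond_loss u \<omega>))"
        unfolding uJ[symmetric] by (auto intro!: INF_greatest)
      then have "z \<le> v \<omega>" unfolding elim(1)[symmetric] by simp
      moreover have "v \<omega> \<le> z" using z(1) vp by (intro LIMSEQ_le_const) auto
      ultimately show ?case using z(1) by simp
    qed
  qed
  have "\<forall>\<^sub>F n in sequentially. (\<integral>\<omega>. p n \<omega> \<partial>M) < (\<integral>\<omega>. v \<omega> \<partial>M) + e / 2"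
    using order_tendstoD(2)[OF lim] e by simp
  then obtain n where n: "(\<integral>\<omega>. p n \<omega> \<partial>M) < (\<integral>\<omega>. v \<omega> \<partial>M) + e / 2"
    by (auto simp: eventually_sequentially)
  obtain w where w: "w \<in> ?D" "(\<integral>\<omega>. \<bar>past_cond_loss w \<omega> - p n \<omega>\<bar> \<partial>M) < e / 2"
    using finite_near_optimal_decision[of u "e / 2" n] u e by (auto simp: p_def)
  have pi: "integrable M (p n)"
  proof (rule Bochner_Integration.integrable_bound[OF F.real_cond_exp_int(1)[OF \<Lambda>] pm])
    show "AE \<omega> in M. norm (p n \<omega>) \<le> norm (real_cond_exp M ?F \<Lambda> \<omega>)"
      using bnd by eventually_elim (metis p_ex real_norm_def abs_ge_self order_trans)
  qed
  have "(\<integral>\<omega>. loss_at M T l 0 w \<omega> \<partial>M) = (\<integral>\<omega>. past_cond_loss w \<omega> \<partial>M)"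
    using F.real_cond_exp_int(2)[OF loss_integrable[OF w(1)]] by simp
  also have "\<dots> = (\<integral>\<omega>. past_cond_loss w \<omega> - p n \<omega> \<partial>M) + (\<integral>\<omega>. p n \<omega> \<partial>M)"
    using ci[OF w(1)] pi by simp
  also have "(\<integral>\<omega>. past_cond_loss w \<omega> - p n \<omega> \<partial>M) \<le> (\<integral>\<omega>. \<bar>past_cond_loss w \<omega> - p n \<omega>\<bar> \<partial>M)"
    using ci[OF w(1)] pi by (intro integral_mono integrable_abs Bochner_Integration.integrable_diff) auto
  also have "\<dots> < e / 2" by (rule w(2))
  finally have "(\<integral>\<omega>. loss_at M T l 0 w \<omega> \<partial>M) < (\<integral>\<omega>. v \<omega> \<partial>M) + e" using n by simp
  also have "(\<integral>\<omega>. v \<omega> \<partial>M) = L_star M T Y U l"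
    unfolding v_def integral_optimal_cond_loss L_star_def ..
  finally show ?thesis using w(1) by blast
qed

end

section \<open>Optimal strategies\<close>

locale reducible_decision_problem = decision_problem M T Y U l \<Lambda>
  for M :: "'a measure" and T and Y and U :: "'u measure" and l and \<Lambda> +
  fixes X :: "'a measure"
  assumes X: "subalgebra M X"
    and X_increasing: "sets X \<subseteq> sets (T_image M T (- 1) X)"
    and future_limit: "tendsto_zero_L1 M (\<lambda>n. family_esssup M (decisions M T Y U 0) (\<lambda>u \<omega>. ereal
           \<bar>real_cond_exp M (field_join M (obs_field M T Y {..0}) (T_image M T (- int n) X))
               (loss_at M T l 0 u) \<omega>
             - loss_at M T l 0 u \<omega>\<bar>))"
    and past_limit: "tendsto_zero_L1 M (\<lambda>n. family_esssup M (decisions M T Y U 0) (\<lambda>u \<omega>. ereal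
           \<bar>real_cond_exp M (field_join M (obs_field M T Y {..0}) (T_image M T (int n) X))
               (loss_at M T l 0 u) \<omega>
             - real_cond_exp M (remote_field M T Y X) (loss_at M T l 0 u) \<omega>\<bar>))"
    and remote_past: "L_star M T Y U l = mean_optimal_loss M T Y U l (remote_field M T Y X)"
begin

abbreviation remote_cond_loss :: "('a \<Rightarrow> 'u) \<Rightarrow> 'a \<Rightarrow> real" where
  "remote_cond_loss u \<equiv> real_cond_exp M (remote_field M T Y X) (loss_at M T l 0 u)"

definition remote_optimal_loss :: "'a \<Rightarrow> real" where
  "remote_optimal_loss = optimal_cond_loss (remote_field M T Y X)"

text \<open>The second claim is where hypothesis 3 enters: the optimum given the remote field has
  the same mean as the optimum given the observed past.\<close>

lemma remote_optimal_loss: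
  shows "integrable M remote_optimal_loss"
    and "(\<integral>\<omega>. remote_optimal_loss \<omega> \<partial>M) = L_star M T Y U l"
    and "u \<in> decisions M T Y U 0 \<Longrightarrow> AE \<omega> in M. remote_optimal_loss \<omega> \<le> remote_cond_loss u \<omega>"
  using optimal_cond_loss(2) optimal_cond_loss_le integral_optimal_cond_loss remote_past
    subalgebra_remote_field[OF Y X] by (auto simp: remote_optimal_loss_def)

text \<open>The envelopes at both ends hold for every member of U_0, so they serve any sequence v,
  including one that changes at every time step.\<close>

lemma loss_LLN:
  assumes v: "\<And>k. v k \<in> decisions M T Y U 0"
  shows "AE \<omega> in M. (\<lambda>N. (\<Sum>k=1..N. loss_at M T l 0 (v k) ((T ^^ k) \<omega>)
    - remote_cond_loss (v k) ((T ^^ k) \<omega>)) / real N) \<longlonglongrightarrow> 0"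
proof (rule past_martingale_LLN[where G = "past_field Y X" and \<Lambda> = \<Lambda>])
  fix e :: real assume e: "e > 0"
  have "\<exists>n d. integrable M d \<and> (\<integral>\<omega>. d \<omega> \<partial>M) < e \<and> (\<forall>u\<in>decisions M T Y U 0. AE \<omega> in M.
      \<bar>real_cond_exp M (past_field Y X (int n)) (loss_at M T l 0 u) \<omega> - loss_at M T l 0 u \<omega>\<bar> \<le> d \<omega>)"
    unfolding past_field_def
    using loss_measurable by (intro family_esssup_dominated[OF _ decisions_nonempty future_limit e]) auto
  then show "\<exists>n d. integrable M d \<and> (\<integral>\<omega>. d \<omega> \<partial>M) < e \<and> (\<forall>k. AE \<omega> in M.
      \<bar>real_cond_exp M (past_field Y X (int n)) (loss_at M T l 0 (v k)) \<omega> - loss_at M T l 0 (v k) \<omega>\<bar> \<le> d \<omega>)"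
    using v by blast
  have "\<exists>n d. integrable M d \<and> (\<integral>\<omega>. d \<omega> \<partial>M) < e \<and> (\<forall>u\<in>decisions M T Y U 0. AE \<omega> in M.
      \<bar>real_cond_exp M (past_field Y X (- int n)) (loss_at M T l 0 u) \<omega> - remote_cond_loss u \<omega>\<bar> \<le> d \<omega>)"
    unfolding past_field_def minus_minus
    by (intro family_esssup_dominated[OF _ decisions_nonempty past_limit e]) auto
  then show "\<exists>n d. integrable M d \<and> (\<integral>\<omega>. d \<omega> \<partial>M) < e \<and> (\<forall>k. AE \<omega> in M.
      \<bar>real_cond_exp M (past_field Y X (- int n)) (loss_at M T l 0 (v k)) \<omega> - remote_cond_loss (v k) \<omega>\<bar> \<le> d \<omega>)"
    using v by blast
qed (use past_field[OF Y X X_increasing] v loss_measurable loss_le \<Lambda> in auto)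

lemma avg_loss_eq:
  assumes "\<omega> \<in> space M" and "\<And>k. k \<ge> 1 \<Longrightarrow> u k \<omega> = v k ((T ^^ k) \<omega>)"
  shows "avg_loss M T l N u \<omega> = (\<Sum>k=1..N. loss_at M T l 0 (v k) ((T ^^ k) \<omega>)) / real N"
  using assms by (simp add: avg_loss_def loss_at_def)

text \<open>Along almost every path, replacing each remote conditional loss by the smaller remote
  optimum turns the average loss into a comparison sequence that converges by
  \<open>loss_LLN\<close> and Birkhoff's theorem.\<close>

lemma avg_loss_lower_bound:
  assumes "admissible M T Y U u"
  shows "AE \<omega> in M. \<exists>a. a \<longlonglongrightarrow> L_star M T Y U l \<and> (\<forall>N. a N \<le> avg_loss M T l N u \<omega>)"
proof -
  \<comment> \<open>Admissibility says nothing about index 0, so \<open>u 1\<close> stands in there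
    and every \<open>v k\<close> is a genuine decision; the averages start at 1.\<close>
  define v where "v k \<omega> = u (max 1 k) (T_pow M T (- int (max 1 k)) \<omega>)" for k \<omega>
  have v: "v k \<in> decisions M T Y U 0" for k
  proof (rule decisions_0I)
    have "u (max 1 k) \<in> decisions_between M T Y U 0 (int (max 1 k))"
      using assms by (simp add: admissible_def)
    then show "v k \<in> decisions_between M T Y U (- int (max 1 k)) 0"
      unfolding v_def[abs_def] by (rule shift_decision) simp_all
  qed
  have uv: "u k \<omega> = v k ((T ^^ k) \<omega>)" if "k \<ge> 1" "\<omega> \<in> space M" for k \<omega>
    using that T_pow_inverse[of \<omega> "- int k" "int k"] by (simp add: v_def max_def)
  have "AE \<omega> in M. \<forall>k. remote_optimal_loss ((T ^^ k) \<omega>) \<le> remote_cond_loss (v k) ((T ^^ k) \<omega>)"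
    unfolding AE_all_countable using AE_funpow[OF remote_optimal_loss(3)[OF v]] by blast
  with loss_LLN[of v, OF v] birkhoff[OF remote_optimal_loss(1)] AE_space show ?thesis
  proof eventually_elim
    case (elim \<omega>)
    define a where "a N = (\<Sum>k=1..N. loss_at M T l 0 (v k) ((T ^^ k) \<omega>) - remote_cond_loss (v k) ((T ^^ k) \<omega>)) / real N
      + (\<Sum>k=1..N. remote_optimal_loss ((T ^^ k) \<omega>)) / real N" for N
    have "a \<longlonglongrightarrow> L_star M T Y U l"
      unfolding a_def[abs_def] using tendsto_add[OF elim(1,2)] by (simp add: remote_optimal_loss(2))
    moreover have "a N \<le> avg_loss M T l N u \<omega>" for N
    proof -
      have "a N = (\<Sum>k=1..N. loss_at M T l 0 (v k) ((T ^^ k) \<omega>) - remote_cond_loss (v k) ((T ^^ k) \<omega>)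
          + remote_optimal_loss ((T ^^ k) \<omega>)) / real N"
        by (simp add: a_def sum.distrib add_divide_distrib)
      also have "\<dots> \<le> (\<Sum>k=1..N. loss_at M T l 0 (v k) ((T ^^ k) \<omega>)) / real N"
        using elim(4) by (intro divide_right_mono sum_mono) (auto simp: algebra_simps)
      also have "\<dots> = avg_loss M T l N u \<omega>"
        by (rule avg_loss_eq[symmetric]) (use uv elim(3) in auto)
      finally show ?thesis .
    qed
    ultimately show ?case by blast
  qed
qed

text \<open>The optimal strategy at time \<open>k\<close> uses the best decision of a minimizing sequence whose memory
  fits into \<open>k\<close> observations.\<close>

lemma optimal_strategy:
  obtains u where "admissible M T Y U u"
    and "AE \<omega> in M. (\<lambda>N. avg_loss M T l N u \<omega>) \<longlonglongrightarrow> L_star M T Y U l"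
proof -
  let ?R = "remote_field M T Y X" and ?D = "decisions M T Y U 0"
  interpret R: finite_measure_subalgebra M ?R
    by (rule finite_measure_subalgebraI[OF subalgebra_remote_field[OF Y X]])
  obtain x where x: "x \<in> space U" using U_nonempty by blast
  \<comment> \<open>Index 0 is a constant decision with memory 0, a fallback available at every
    time; near-optimality is asked only for j > 0.\<close>
  have "\<exists>w m. w \<in> decisions_between M T Y U (- int m) 0 \<and> (j = 0 \<longrightarrow> m = 0) \<and>
      (0 < j \<longrightarrow> (\<integral>\<omega>. loss_at M T l 0 w \<omega> \<partial>M) < L_star M T Y U l + (1 / 2) ^ j)" for j :: nat
  proof (cases "j = 0")
    case True
    then show ?thesis using const_decision[OF x, of 0 0] by (intro exI[of _ "\<lambda>_. x"] exI[of _ 0]) simp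
  next
    case False
    obtain w where w: "w \<in> ?D" "(\<integral>\<omega>. loss_at M T l 0 w \<omega> \<partial>M) < L_star M T Y U l + (1 / 2) ^ j"
      using near_optimal_decision[of "(1 / 2) ^ j"] by auto
    then show ?thesis using decisions_0_cases[OF w(1)] False by metis
  qed
  then obtain vs m where vs: "\<And>j. vs j \<in> decisions_between M T Y U (- int (m j)) 0" and m0: "m 0 = (0::nat)"
    and near: "\<And>j. 0 < j \<Longrightarrow> (\<integral>\<omega>. loss_at M T l 0 (vs j) \<omega> \<partial>M) < L_star M T Y U l + (1 / 2) ^ j"
    by metis
  have D: "vs j \<in> ?D" for j by (rule decisions_0I[OF vs])
  \<comment> \<open>The restriction to \<open>{..k}\<close> makes the set finite and
    \<open>m 0 = 0\<close> makes it nonempty. As each j enters once k reaches max j (m j), r tends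
    to infinity at the speed the memories permit.\<close>
  define r where "r k = Max {j\<in>{..k}. m j \<le> k}" for k
  have fin: "finite {j\<in>{..k}. m j \<le> k}" for k by simp
  have r_in: "m (r k) \<le> k" for k
  proof -
    have "0 \<in> {j\<in>{..k}. m j \<le> k}" using m0 by simp
    then have "r k \<in> {j\<in>{..k}. m j \<le> k}" unfolding r_def by (intro Max_in fin) blast
    then show ?thesis by simp
  qed
  have r_ge: "j \<le> r k" if "max j (m j) \<le> k" for j k
    unfolding r_def using that by (intro Max_ge fin) auto
  define u where "u k \<omega> = vs (r k) ((T ^^ k) \<omega>)" for k \<omega>
  have adm: "admissible M T Y U u"
    unfolding admissible_def
  proof (intro allI impI)
    fix k :: nat
    have "vs (r k) \<in> decisions_between M T Y U (- int k) 0"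
      using vs[of "r k"] decisions_between_mono[of "- int k" "- int (m (r k))" 0 0] r_in[of k] by auto
    from shift_decision[OF this, of 0 "int k" "int k"]
    show "u k \<in> decisions_between M T Y U 0 (int k)" by (simp add: u_def[abs_def])
  qed
  define g where "g j \<omega> = remote_cond_loss (vs j) \<omega> - remote_optimal_loss \<omega>" for j \<omega>
  have gi: "integrable M (g j)" for j
    unfolding g_def using R.real_cond_exp_int(1)[OF loss_integrable[OF D]] remote_optimal_loss(1) by simp
  have g_nonneg: "AE \<omega> in M. 0 \<le> g j \<omega>" for j
    using remote_optimal_loss(3)[OF D, of j] by eventually_elim (simp add: g_def)
  have [measurable]: "g j \<in> borel_measurable M" for j using gi by auto
  \<comment> \<open>Conditioning preserves the mean loss and the remote optimum has mean
    \<open>L_star\<close>, so the mean excess is exactly the distance of the mean loss from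
    \<open>L_star\<close>.\<close>
  have g_le: "(\<integral>\<^sup>+\<omega>. ennreal (g j \<omega>) \<partial>M) \<le> ennreal ((1 / 2) ^ j)" if "0 < j" for j
  proof -
    have "(\<integral>\<omega>. g j \<omega> \<partial>M) = (\<integral>\<omega>. loss_at M T l 0 (vs j) \<omega> \<partial>M) - L_star M T Y U l"
      unfolding g_def using R.real_cond_exp_int[OF loss_integrable[OF D]] remote_optimal_loss(1,2) by simp
    also have "\<dots> \<le> (1 / 2) ^ j" using near[OF that] by simp
    finally show ?thesis using nn_integral_eq_integral[OF gi g_nonneg] by (simp add: ennreal_leI)
  qed
  have "AE \<omega> in M. (\<lambda>N. (\<Sum>k=1..N. g (r k) ((T ^^ k) \<omega>)) / real N) \<longlonglongrightarrow> 0"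
  proof (rule AE_tendsto_zeroI)
    fix e :: real assume e: "e > 0"
    obtain J :: nat where J: "(1 / 2) ^ J < e / 2"
      using real_arch_pow_inv[of "e / 2" "1 / 2"] e by auto
    \<comment> \<open>Summing all excesses with index beyond J gives a single envelope whatever
      index \<open>r k\<close> selects; its mean is at most the geometric tail 2^{-J}.\<close>
    define q where "q \<omega> = (\<Sum>i. ennreal (g (Suc J + i) \<omega>))" for \<omega>
    have qm: "q \<in> borel_measurable M" unfolding q_def by measurable
    have "(\<integral>\<^sup>+\<omega>. q \<omega> \<partial>M) = (\<Sum>i. \<integral>\<^sup>+\<omega>. ennreal (g (Suc J + i) \<omega>) \<partial>M)"
      unfolding q_def by (intro nn_integral_suminf) simp
    also have "\<dots> \<le> (\<Sum>i. ennreal ((1 / 2) ^ (Suc J + i)))"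
      by (intro suminf_le g_le) auto
    also have "\<dots> = ennreal ((1 / 2) ^ J)"
    proof (rule suminf_ennreal_eq)
      have "(\<lambda>i. (1 / 2) ^ Suc J * (1 / 2) ^ i) sums ((1 / 2) ^ Suc J * (1 / (1 - 1 / 2 :: real)))"
        by (intro sums_mult geometric_sums) simp
      then show "(\<lambda>i. (1 / 2) ^ (Suc J + i)) sums ((1 / 2) ^ J :: real)"
        by (simp add: power_add)
    qed simp
    also have "\<dots> < ennreal (e / 2)" using J by (intro ennreal_lessI) (auto simp: e)
    finally have q: "(\<integral>\<^sup>+\<omega>. q \<omega> \<partial>M) < ennreal (e / 2)" .
    note q = integrable_enn2real[OF qm q]
    \<comment> \<open>Drops the times at which r has not yet passed J. There are finitely many of
      them, so the averages are unaffected in the limit.\<close>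
    define f where "f k \<omega> = (if J < r k then g (r k) \<omega> else 0)" for k \<omega>
    have "AE \<omega> in M. \<bar>f k \<omega>\<bar> \<le> enn2real (q \<omega>)" for k
      using q(3) g_nonneg[of "r k"]
    proof eventually_elim
      case (elim \<omega>)
      show ?case
      proof (cases "J < r k")
        case True
        then obtain i where i: "r k = Suc J + i" using less_iff_Suc_add by auto
        have "ennreal (g (Suc J + i) \<omega>) \<le> q \<omega>"
          unfolding q_def using sum_le_suminf[of "\<lambda>i. ennreal (g (Suc J + i) \<omega>)" "{i}"] by simp
        then have "ennreal (g (r k) \<omega>) \<le> ennreal (enn2real (q \<omega>))" using elim i by simp
        then have "g (r k) \<omega> \<le> enn2real (q \<omega>)" by (rule ennreal_le_iff[THEN iffD1, rotated]) simp
        then show ?thesis using True elim by (simp add: f_def)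
      qed (simp add: f_def)
    qed
    then have "AE \<omega> in M. \<forall>\<^sub>F N in sequentially. \<bar>(\<Sum>k=1..N. f k ((T ^^ k) \<omega>)) / real N\<bar> \<le> e / 2"
      by (rule avg_eventually_le[OF q(1,2)])
    then show "AE \<omega> in M. \<forall>\<^sub>F N in sequentially. \<bar>(\<Sum>k=1..N. g (r k) ((T ^^ k) \<omega>)) / real N\<bar> \<le> e"
    proof eventually_elim
      case (elim \<omega>)
      have "g (r k) ((T ^^ k) \<omega>) = f k ((T ^^ k) \<omega>)" if "max (Suc J) (m (Suc J)) \<le> k" for k
        using r_ge[OF that] by (simp add: f_def)
      from ignore_initial_terms[OF this]
      have "(\<lambda>N. (\<Sum>k=1..N. g (r k) ((T ^^ k) \<omega>)) / real N - (\<Sum>k=1..N. f k ((T ^^ k) \<omega>)) / real N) \<longlonglongrightarrow> 0" .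
      from tendstoD[OF this, of "e / 2"] e
      have "\<forall>\<^sub>F N in sequentially. \<bar>(\<Sum>k=1..N. g (r k) ((T ^^ k) \<omega>)) / real N - (\<Sum>k=1..N. f k ((T ^^ k) \<omega>)) / real N\<bar> < e / 2"
        by (simp add: dist_real_def)
      with elim show ?case by eventually_elim linarith
    qed
  qed
  with loss_LLN[of "\<lambda>k. vs (r k)", OF D] birkhoff[OF remote_optimal_loss(1)] AE_space
  have "AE \<omega> in M. (\<lambda>N. avg_loss M T l N u \<omega>) \<longlonglongrightarrow> L_star M T Y U l"
  proof eventually_elim
    case (elim \<omega>)
    have "avg_loss M T l N u \<omega> = (\<Sum>k=1..N. loss_at M T l 0 (vs (r k)) ((T ^^ k) \<omega>) - remote_cond_loss (vs (r k)) ((T ^^ k) \<omega>)) / real N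
      + (\<Sum>k=1..N. g (r k) ((T ^^ k) \<omega>)) / real N
      + (\<Sum>k=1..N. remote_optimal_loss ((T ^^ k) \<omega>)) / real N" for N
    proof -
      have "avg_loss M T l N u \<omega> = (\<Sum>k=1..N. loss_at M T l 0 (vs (r k)) ((T ^^ k) \<omega>)) / real N"
        by (rule avg_loss_eq) (use elim(3) in \<open>auto simp: u_def\<close>)
      then show ?thesis
        by (simp add: g_def sum_subtractf flip: add_divide_distrib)
    qed
    then show ?case
      using tendsto_add[OF tendsto_add[OF elim(1,4)] elim(2)] by (simp add: remote_optimal_loss(2))
  qed
  with adm that show ?thesis by blast
qed

end

theorem theorem2p6:
  fixes M Y X :: "'a measure" and U :: "'u measure"
    and T :: "'a \<Rightarrow> 'a" and l :: "'u \<Rightarrow> 'a \<Rightarrow> real" and \<Lambda> :: "'a \<Rightarrow> real"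
  assumes "prob_space M"
    and "subalgebra M Y"
    and "invertible_measure_preserving M T"
    and "ergodic_transformation M T"
    and "(\<lambda>(u, \<omega>). l u \<omega>) \<in> borel_measurable (U \<Otimes>\<^sub>M M)"
    and "integrable M \<Lambda>"
    and "\<And>u \<omega>. u \<in> space U \<Longrightarrow> \<omega> \<in> space M \<Longrightarrow> \<bar>l u \<omega>\<bar> \<le> \<Lambda> \<omega>"
    and "subalgebra M X"
    and "sets X \<subseteq> sets (T_image M T (- 1) X)"
    and "tendsto_zero_L1 M (\<lambda>n. family_esssup M (decisions M T Y U 0) (\<lambda>u \<omega>. ereal
           \<bar>real_cond_exp M (field_join M (obs_field M T Y {..0}) (T_image M T (- int n) X))
               (loss_at M T l 0 u) \<omega>
             - loss_at M T l 0 u \<omega>\<bar>))"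
    and "tendsto_zero_L1 M (\<lambda>n. family_esssup M (decisions M T Y U 0) (\<lambda>u \<omega>. ereal
           \<bar>real_cond_exp M (field_join M (obs_field M T Y {..0}) (T_image M T (int n) X))
               (loss_at M T l 0 u) \<omega>
             - real_cond_exp M (remote_field M T Y X) (loss_at M T l 0 u) \<omega>\<bar>))"
    and "L_star M T Y U l = mean_optimal_loss M T Y U l (remote_field M T Y X)"
  shows "\<exists>u_star. admissible M T Y U u_star \<and>
           (\<forall>u. admissible M T Y U u \<longrightarrow>
              (AE \<omega> in M. 0 \<le> liminf (\<lambda>N. ereal (avg_loss M T l N u \<omega> - avg_loss M T l N u_star \<omega>)))) \<and>
           (AE \<omega> in M. (\<lambda>N. avg_loss M T l N u_star \<omega>) \<longlonglongrightarrow> L_star M T Y U l)"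
proof -
  interpret prob_space M by fact
  have "space U \<noteq> {}"
  proof -
    obtain u where "u \<in> decisions M T Y U 0"
      using family_esssup_L1_limit_nonempty[OF assms(1,10)] by blast
    then obtain m where u: "u \<in> obs_field M T Y {m..0} \<rightarrow>\<^sub>M U"
      by (auto simp: decisions_def decisions_between_def)
    obtain \<omega> where "\<omega> \<in> space (obs_field M T Y {m..0})"
      using not_empty by (auto simp: obs_field_def space_measure_of_conv)
    from measurable_space[OF u this] show ?thesis by blast
  qed
  then interpret reducible_decision_problem M T Y U l \<Lambda> X
    by unfold_locales (use assms in auto)
  obtain u_star where adm: "admissible M T Y U u_star"
    and lim: "AE \<omega> in M. (\<lambda>N. avg_loss M T l N u_star \<omega>) \<longlonglongrightarrow> L_star M T Y U l"
    by (rule optimal_strategy)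
  have "AE \<omega> in M. 0 \<le> liminf (\<lambda>N. ereal (avg_loss M T l N u \<omega> - avg_loss M T l N u_star \<omega>))"
    if "admissible M T Y U u" for u
    using avg_loss_lower_bound[OF that] lim
  proof eventually_elim
    case (elim \<omega>)
    then obtain a where a: "a \<longlonglongrightarrow> L_star M T Y U l" "\<And>N. a N \<le> avg_loss M T l N u \<omega>" by blast
    \<comment> \<open>The average losses of u may fail to converge; their minorant a does, and
      liminf is monotone.\<close>
    have "(\<lambda>N. ereal (a N - avg_loss M T l N u_star \<omega>)) \<longlonglongrightarrow> ereal 0"
      using tendsto_diff[OF a(1) elim(2)] by simp
    then have "liminf (\<lambda>N. ereal (a N - avg_loss M T l N u_star \<omega>)) = 0"
      by (simp add: lim_imp_Liminf zero_ereal_def)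
    moreover have "liminf (\<lambda>N. ereal (a N - avg_loss M T l N u_star \<omega>))
        \<le> liminf (\<lambda>N. ereal (avg_loss M T l N u \<omega> - avg_loss M T l N u_star \<omega>))"
      using a(2) by (intro Liminf_mono) simp
    ultimately show ?case by simp
  qed
  with adm lim show ?thesis by blast
qed

end
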